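(* In the setting described in the context (linear drift): for all $\varepsilon>0$, $$\lim_{t_0\to\infty}\limsup_{N\to\infty}\mathbb P\left(\sup_{t\ge t_0}e^{-\lambda t}\,|X_t^N-\phi_{t-t_0}(X^N_{t_0})|>N^{-1/2}\varepsilon\right)=0.$$
   Context: For each $N\in\mathbb N$, $(X_t^N)_{t\ge0}$ is a pure jump Markov process with $X_0^N=x_0$, taking values in $I^N\subset\mathbb R^2$, with Lévy kernel $K^N(x,dy)$ (jumps from $x$ to $x+y$ occur at rate $K^N(x,dy)$). $S\subset\mathbb R^2$ is open, $x_0\in S$, $S^N=I^N\cap S$, and $m^N(x,\theta)=\int_{\mathbb R^2}e^{\langle\theta,y\rangle}K^N(x,dy)$ for $x\in S^N$, $\theta\in(\mathbb R^2)^*$. There is a limit kernel $K(x,dy)$, $x\in S$, with Laplace transform $m(x,\theta)=\int e^{\langle\theta,y\rangle}K(x,dy)$, such that, with $'$ denoting differentiation in $\theta$: (a) for some $\eta_0>0$, $m(x,\theta)$ is uniformly bounded for $x\in S$, $|\theta|\le\eta_0$; (b) $\sup_{x\in S^N}\sup_{|\theta|\le\eta_0}|m^N(x,N\theta)/N-m(x,\theta)|\to0$ as $N\to\infty$; (c) with $b(x)=m'(x,0)$ and $b^N(x)=(m^N)'(x,0)$, $\sup_{x\in S^N}N^{1/2}|b^N(x)-b(x)|\to0$; (d) $a(x)=m''(x,0)$ is Lipschitz on $S$. Linear case: $b(x)=Bx$, $B=\begin{pmatrix}-\mu&0\\0&\lambda\end{pmatrix}$, $\lambda,\mu>0$; $\phi_t(x)=e^{Bt}x$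 is the solution of $\dot\phi_t(x)=B\phi_t(x)$, $\phi_0(x)=x$; $x_0=(x_{0,1},0)$ with $x_{0,1}\ne0$; $x_t=\phi_t(x_0)=e^{-\mu t}x_0$. $S$ contains a neighbourhood of the path $(x_t)_{t\ge0}$. By stopping $X^N$ at the first time it leaves $S$, if necessary, it is assumed that $X_t^N$ remains in $\overline S$ for all $t\ge0$.
   Formalization: The supremum is taken only over times t ≥ t_0 up to and including the first exit of X^N from S; over all t ≥ t_0 the claim fails, since S is bounded and X^N stays in its closure, so the scaled deviation tends to e^{-λt_0}|X^N_{t_0,2}|. *)

theory Defs
  imports "HOL-Probability.Probability"
begin

section \<open>Finite kernels and their Laplace transforms\<close>

definition finite_kernel_on :: "(real^2) set \<Rightarrow> (real^2 \<Rightarrow> (real^2) measure) \<Rightarrow> bool" where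
  "finite_kernel_on D K \<longleftrightarrow>
     (\<forall>x\<in>D. sets (K x) = sets borel \<and> finite_measure (K x)) \<and>
     (\<forall>A\<in>sets borel. (\<lambda>x. emeasure (K x) A) \<in> borel_measurable (restrict_space borel D))"

text \<open>The dual of the plane is identified with the plane through the inner product. The transform
  takes values in the extended half-line, so that divergence is visible: a Bochner integral would
  silently be zero there. Only the derivatives below pass to real values.\<close>

definition laplace :: "(real^2) measure \<Rightarrow> real^2 \<Rightarrow> ennreal" where
  "laplace \<kappa> \<theta> = (\<integral>\<^sup>+ y. ennreal (exp (\<theta> \<bullet> y)) \<partial>\<kappa>)"

definition grad :: "(real^2 \<Rightarrow> real) \<Rightarrow> real^2 \<Rightarrow> real^2" where
  "grad f x = (\<chi> i. frechet_derivative f (at x) (axis i 1))"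

lemma grad_eq:
  assumes "(f has_derivative (\<lambda>h. v \<bullet> h)) (at x)"
  shows "grad f x = v"
proof -
  have "frechet_derivative f (at x) = (\<lambda>h. v \<bullet> h)"
    using frechet_derivative_at[OF assms] by simp
  then show ?thesis
    by (simp add: grad_def vec_eq_iff inner_axis)
qed

text \<open>First and second derivative of the Laplace transform at the origin, as a vector and as a
  (Hessian) matrix.\<close>

definition drift :: "(real^2) measure \<Rightarrow> real^2" where
  "drift \<kappa> = grad (\<lambda>\<theta>. enn2real (laplace \<kappa> \<theta>)) 0"

definition diffusivity :: "(real^2) measure \<Rightarrow> real^2^2" where
  "diffusivity \<kappa> = (\<chi> i. grad (\<lambda>\<theta>. grad (\<lambda>\<theta>. enn2real (laplace \<kappa> \<theta>)) \<theta> $ i) 0)"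


section \<open>Pure jump Markov processes\<close>

text \<open>Jump chain and holding time definition. \<open>J n\<close> is the time of the \<open>n\<close>-th jump (infinite if
  there are fewer jumps) and \<open>Y n\<close> the state entered at that time; \<open>jump_history M J Y n\<close> is the
  sigma-algebra generated by the first \<open>n\<close> jumps. Given this history, with current state \<open>x\<close> and total
  rate \<open>q = K x UNIV\<close>, the holding time is exponential of rate \<open>q\<close> and is independent of the jump,
  which has law \<open>K x / q\<close>. In an absorbing state, \<open>q = 0\<close>, the right hand side of the last clause
  is zero because division by zero is zero, so there is almost surely no further jump. The process
  does not explode. Mass of \<open>K x\<close> at the origin is not excluded; it produces jumps of size zero,
  which do not change the path.\<close>

definition jump_history ::
    "'w measure \<Rightarrow> (nat \<Rightarrow> 'w \<Rightarrow> ereal) \<Rightarrow> (nat \<Rightarrow> 'w \<Rightarrow> real^2) \<Rightarrow> nat \<Rightarrow> 'w measure" where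
  "jump_history M J Y n =
     vimage_algebra (space M) (\<lambda>\<omega>. \<lambda>k\<in>{..n}. (J k \<omega>, Y k \<omega>)) (Pi\<^sub>M {..n} (\<lambda>_. borel \<Otimes>\<^sub>M borel))"

definition pure_jump_markov ::
    "'w measure \<Rightarrow> (real^2) set \<Rightarrow> (real^2 \<Rightarrow> (real^2) measure) \<Rightarrow> real^2 \<Rightarrow>
     (real \<Rightarrow> 'w \<Rightarrow> real^2) \<Rightarrow> bool" where
  "pure_jump_markov M I K x\<^sub>0 X \<longleftrightarrow> prob_space M \<and> finite_kernel_on I K \<and>
     (\<exists>(J :: nat \<Rightarrow> 'w \<Rightarrow> ereal) (Y :: nat \<Rightarrow> 'w \<Rightarrow> real^2).
        (\<forall>n. J n \<in> borel_measurable M \<and> Y n \<in> borel_measurable M) \<and>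
        (\<forall>\<omega>\<in>space M.
           J 0 \<omega> = 0 \<and> Y 0 \<omega> = x\<^sub>0 \<and>
           (\<forall>n. Y n \<omega> \<in> I) \<and>
           (\<forall>n. J n \<omega> \<le> J (Suc n) \<omega> \<and> (J n \<omega> < \<infinity> \<longrightarrow> J n \<omega> < J (Suc n) \<omega>)) \<and>
           (\<forall>t::real. \<exists>n. ereal t < J n \<omega>) \<and>
           (\<forall>n t. J n \<omega> \<le> ereal t \<and> ereal t < J (Suc n) \<omega> \<longrightarrow> X t \<omega> = Y n \<omega>)) \<and>
        (\<forall>n. \<forall>s\<ge>0. \<forall>B\<in>sets borel. AE \<omega> in M.
           real_cond_exp M (jump_history M J Y n)
             (indicator {\<omega> \<in> space M. J n \<omega> + ereal s < J (Suc n) \<omega> \<and> J (Suc n) \<omega> < \<infinity> \<and>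
                                      Y (Suc n) \<omega> - Y n \<omega> \<in> B}) \<omega> =
           (if J n \<omega> = \<infinity> then 0
            else exp (- measure (K (Y n \<omega>)) UNIV * s) *
                 (measure (K (Y n \<omega>)) B / measure (K (Y n \<omega>)) UNIV))))"

definition exit_time :: "(real^2) set \<Rightarrow> (real \<Rightarrow> 'w \<Rightarrow> real^2) \<Rightarrow> 'w \<Rightarrow> ereal" where
  "exit_time S X \<omega> = (INF t\<in>{t. 0 \<le> t \<and> X t \<omega> \<notin> S}. ereal t)"


section \<open>The linear saddle\<close>

definition saddle_matrix :: "real \<Rightarrow> real \<Rightarrow> real^2^2" where
  "saddle_matrix \<mu> l = vector [vector [- \<mu>, 0], vector [0, l]]"

definition saddle_flow :: "real \<Rightarrow> real \<Rightarrow> real \<Rightarrow> real^2 \<Rightarrow> real^2" where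
  "saddle_flow \<mu> l t x = vector [exp (- \<mu> * t) * x $ 1, exp (l * t) * x $ 2]"

lemma saddle_flow_0: "saddle_flow \<mu> l 0 x = x"
  by (simp add: saddle_flow_def vec_eq_iff forall_2)

lemma saddle_flow_ode:
  "((\<lambda>t. saddle_flow \<mu> l t x) has_vector_derivative
      saddle_matrix \<mu> l *v saddle_flow \<mu> l t x) (at t)"
proof -
  have eq: "saddle_flow \<mu> l =
      (\<lambda>t x. (exp (- \<mu> * t) * x $ 1) *\<^sub>R axis 1 1 + (exp (l * t) * x $ 2) *\<^sub>R axis 2 1)"
    by (simp add: fun_eq_iff saddle_flow_def vec_eq_iff forall_2 axis_def)
  have "saddle_matrix \<mu> l *v saddle_flow \<mu> l t x =
      (- \<mu> * (exp (- \<mu> * t) * x $ 1)) *\<^sub>R axis 1 1 + (l * (exp (l * t) * x $ 2)) *\<^sub>R axis 2 1"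
    by (simp add: saddle_flow_def saddle_matrix_def vec_eq_iff forall_2 axis_def
        matrix_vector_mult_def sum_2)
  then show ?thesis
    unfolding eq by (auto intro!: derivative_eq_intros simp: mult_ac)
qed

end

theory Submission
  imports Defs
begin

text \<open>
  Write \<open>U t = X t - saddle_flow \<mu> l (t - t\<^sub>0) (X t\<^sub>0)\<close> for the deviation of the process from the
  flow restarted at time \<open>t\<^sub>0\<close>, and \<open>B\<close> for the matrix of the saddle. The restarted flow solves \<open>f' = B f\<close>, and the process has drift
  \<open>B X\<close> up to an error \<open>\<delta>\<close> of order \<open>N powr (- 1/2)\<close>, so \<open>U\<close> itself has drift \<open>B U\<close> up to that error. Since
  \<open>U \<bullet> B U \<le> l |U|^2\<close>, the weight \<open>exp (- 2 l t)\<close> exactly absorbs the growth of \<open>|U|^2\<close>: the drift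
  of \<open>exp (- 2 l t) |U|^2\<close> is at most \<open>exp (- 2 l t) (2 |U| \<delta> + v)\<close>, where \<open>v\<close> bounds
  the second moment of the jump kernel and is of order \<open>1 / N\<close>. Replacing the weight by
  \<open>(1 + exp (- l t)) exp (- 2 l t)\<close> gains a negative multiple of \<open>|U|^2\<close> that absorbs the cross term, and
  adding \<open>d exp (- l t)\<close> with \<open>d\<close> of order \<open>1 / N\<close> absorbs what remains. The resulting function
  \<open>lyapunov\<close> is a nonnegative supermartingale from time \<open>t\<^sub>0\<close> until the exit from \<open>S\<close>. It starts from
  \<open>d exp (- l t\<^sub>0)\<close>, because \<open>U\<close> vanishes at \<open>t\<^sub>0\<close>, and it dominates \<open>exp (- 2 l t) |U|^2\<close>. The maximal
  inequality at level \<open>\<epsilon>^2 / N\<close> therefore bounds the probability in question by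
  a constant times \<open>exp (- l t\<^sub>0) / \<epsilon>^2\<close>, uniformly in large \<open>N\<close>.

  The supermartingale argument is carried out along the jump chain. Conditionally on the first \<open>n\<close>
  jumps, the next holding time and the next jump have an explicit joint law
  (\<open>nn_integral_next_jump\<close>). Between jumps the deviation evolves deterministically, so it may cross
  the level in the middle of a holding interval; the one-step inequality \<open>holding_interval\<close> stops at that crossing time
  and charges the level for it. Summed over the steps, it becomes the maximal inequality
  \<open>prob_crossing_le\<close>. The bounds on the Laplace transforms, with their
  argument scaled by \<open>N\<close>, yield the mean and the second moment of the jumps (\<open>laplace_bound_drift\<close>, \<open>laplace_bound_second_moment\<close>).
\<close>

section \<open>Moments of a measure with finite Laplace transform near the origin\<close>

text \<open>An exponential moment of the norm is dominated by the Laplace transform at finitely many points: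
  whatever the signs of the two coordinates, one of the four exponents below equals
  \<open>a (|y\<^sub>1| + |y\<^sub>2|)\<close>.\<close>
lemma exp_norm_le_corners:
  fixes y :: "real^2"
  assumes "a \<ge> 0"
  shows "exp (a * norm y) \<le> exp (vector [a, a] \<bullet> y) + exp (vector [a, - a] \<bullet> y)
    + exp (vector [- a, a] \<bullet> y) + exp (vector [- a, - a] \<bullet> y)"
proof -
  have "norm y \<le> \<bar>y $ 1\<bar> + \<bar>y $ 2\<bar>"
    using norm_le_l1_cart[of y] by (simp add: sum_2)
  then have "exp (a * norm y) \<le> exp (a * \<bar>y $ 1\<bar> + a * \<bar>y $ 2\<bar>)"
    using mult_left_mono[OF _ assms] by (fastforce simp: distrib_left)
  also have "\<dots> \<le> exp (a * y $ 1 + a * y $ 2) + exp (a * y $ 1 - a * y $ 2)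
      + exp (- a * y $ 1 + a * y $ 2) + exp (- a * y $ 1 - a * y $ 2)"
    by (cases "y $ 1 \<ge> 0"; cases "y $ 2 \<ge> 0") (simp_all add: add_nonneg_nonneg)
  finally show ?thesis
    by (simp add: inner_vec_def sum_2)
qed

lemma exp_norm_integral_le_laplace:
  fixes \<kappa> :: "(real^2) measure"
  assumes sets: "sets \<kappa> = sets borel" and a: "a \<ge> 0"
    and bound: "\<And>\<theta>. norm \<theta> \<le> 2 * a \<Longrightarrow> laplace \<kappa> \<theta> \<le> C"
  shows "(\<integral>\<^sup>+ y. ennreal (exp (a * norm y)) \<partial>\<kappa>) \<le> 4 * C"
proof -
  note [measurable_cong] = sets
  have corner: "laplace \<kappa> (vector [s, t]) \<le> C" if "\<bar>s\<bar> = a" "\<bar>t\<bar> = a" for s t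
  proof (rule bound)
    show "norm (vector [s, t] :: real^2) \<le> 2 * a"
      using norm_le_l1_cart[of "vector [s, t] :: real^2"] that by (simp add: sum_2)
  qed
  have "(\<integral>\<^sup>+ y. ennreal (exp (a * norm y)) \<partial>\<kappa>) \<le>
      (\<integral>\<^sup>+ y. ennreal (exp (vector [a, a] \<bullet> y)) + ennreal (exp (vector [a, - a] \<bullet> y))
      + ennreal (exp (vector [- a, a] \<bullet> y)) + ennreal (exp (vector [- a, - a] \<bullet> y)) \<partial>\<kappa>)"
    by (intro nn_integral_mono) (simp add: exp_norm_le_corners[OF a] add_nonneg_nonneg flip: ennreal_plus)
  also have "\<dots> = laplace \<kappa> (vector [a, a]) + laplace \<kappa> (vector [a, - a])
      + laplace \<kappa> (vector [- a, a]) + laplace \<kappa> (vector [- a, - a])"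
    by (simp add: laplace_def nn_integral_add)
  also have "\<dots> \<le> C + C + C + C"
    using a by (intro add_mono corner) auto
  also have "\<dots> = 4 * C"
  proof -
    have "4 * C = (1 + 1 + 1 + 1) * C" by simp
    then show ?thesis by (simp only: distrib_right mult_1_left)
  qed
  finally show ?thesis .
qed

lemma power2_le_exp:
  fixes a x :: real
  assumes "a > 0" "x \<ge> 0"
  shows "x\<^sup>2 \<le> 2 / a\<^sup>2 * exp (a * x)"
  using exp_lower_Taylor_quadratic[of "a * x"] assms
  by (simp add: field_simps power_mult_distrib) (smt (verit) mult_nonneg_nonneg)

lemma abs_exp_minus_linear_le:
  fixes u :: real
  shows "\<bar>exp u - 1 - u\<bar> \<le> u\<^sup>2 * exp \<bar>u\<bar>"
proof -
  obtain t where t: "\<bar>t\<bar> \<le> \<bar>u\<bar>" "exp u = (\<Sum>m<2. u ^ m / fact m) + exp t / fact 2 * u ^ 2"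
    using Maclaurin_exp_le[of u 2] by auto
  then have "\<bar>exp u - 1 - u\<bar> = exp t / 2 * u\<^sup>2"
    by (simp add: eval_nat_numeral)
  also have "\<dots> \<le> exp \<bar>u\<bar> * u\<^sup>2"
    using t(1) exp_gt_zero[of t] by (intro mult_right_mono) (smt (verit) exp_le_cancel_iff field_sum_of_halves, simp)
  finally show ?thesis by (simp add: mult.commute)
qed

text \<open>The function \<open>drift\<close> is a gradient of the Laplace transform at the origin. Under an exponential moment it is the mean,
  because the second order Taylor remainder of \<open>exp (\<theta> \<bullet> y)\<close> is bounded by \<open>|\<theta>|^2\<close>
  times one integrable function of \<open>y\<close>.\<close>
lemma
  fixes \<kappa> :: "(real^2) measure"
  assumes sets: "sets \<kappa> = sets borel" and fin: "finite_measure \<kappa>" and a: "a > 0"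
    and int: "integrable \<kappa> (\<lambda>y. exp (a * norm y))"
  shows integrable_square_if_exp: "integrable \<kappa> (\<lambda>y. (norm y)\<^sup>2)"
    and integrable_id_if_exp: "integrable \<kappa> (\<lambda>y. y)"
    and second_moment_le_exp: "(\<integral>y. (norm y)\<^sup>2 \<partial>\<kappa>) \<le> 2 / a\<^sup>2 * (\<integral>y. exp (a * norm y) \<partial>\<kappa>)"
    and drift_eq_integral: "drift \<kappa> = (\<integral>y. y \<partial>\<kappa>)"
proof -
  interpret finite_measure \<kappa> by fact
  note [measurable_cong] = sets
  show sq: "integrable \<kappa> (\<lambda>y. (norm y)\<^sup>2)"
    by (rule Bochner_Integration.integrable_bound[OF integrable_mult_right[OF int, of "2 / a\<^sup>2"]])
      (use power2_le_exp[OF a] in \<open>auto\<close>)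
  show id: "integrable \<kappa> (\<lambda>y. y)"
  proof (rule Bochner_Integration.integrable_bound[OF Bochner_Integration.integrable_add[OF integrable_const[of 1] sq]])
    have "norm y \<le> norm (1 + (norm y)\<^sup>2)" for y :: "real^2"
      using zero_le_power2[of "norm y - 1"] norm_ge_zero[of y] 
      by (simp add: power2_diff) (smt (verit) zero_le_power2)
    then show "AE y in \<kappa>. norm y \<le> norm (1 + (norm y)\<^sup>2)" by simp
  qed auto
  have "(\<integral>y. (norm y)\<^sup>2 \<partial>\<kappa>) \<le> (\<integral>y. 2 / a\<^sup>2 * exp (a * norm y) \<partial>\<kappa>)"
    by (intro integral_mono sq integrable_mult_right int power2_le_exp a) auto
  then show "(\<integral>y. (norm y)\<^sup>2 \<partial>\<kappa>) \<le> 2 / a\<^sup>2 * (\<integral>y. exp (a * norm y) \<partial>\<kappa>)"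
    by simp
  define v where "v = (\<integral>y. y \<partial>\<kappa>)"
  define D where "D = 8 / a\<^sup>2 * (\<integral>y. exp (a * norm y) \<partial>\<kappa>)"
  have laplace_eq: "enn2real (laplace \<kappa> \<theta>) = (\<integral>y. exp (\<theta> \<bullet> y) \<partial>\<kappa>)" for \<theta>
    unfolding laplace_def by (subst integral_eq_nn_integral) auto
  have int_exp: "integrable \<kappa> (\<lambda>y. exp (\<theta> \<bullet> y))" if "norm \<theta> \<le> a" for \<theta>
  proof (rule Bochner_Integration.integrable_bound[OF int])
    have "\<theta> \<bullet> y \<le> a * norm y" for y
      using norm_cauchy_schwarz[of \<theta> y] mult_right_mono[OF that norm_ge_zero[of y]] by linarith
    then show "AE y in \<kappa>. norm (exp (\<theta> \<bullet> y)) \<le> norm (exp (a * norm y))" by simp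
  qed simp
  have remainder: "\<bar>exp (\<theta> \<bullet> y) - 1 - \<theta> \<bullet> y\<bar> \<le> (norm \<theta>)\<^sup>2 * (8 / a\<^sup>2 * exp (a * norm y))"
    if \<theta>: "norm \<theta> \<le> a / 2" for \<theta> y
  proof -
    have *: "\<bar>\<theta> \<bullet> y\<bar> \<le> norm \<theta> * norm y" by (rule Cauchy_Schwarz_ineq2)
    also have "\<dots> \<le> a / 2 * norm y" by (intro mult_right_mono \<theta>) simp
    finally have **: "\<bar>\<theta> \<bullet> y\<bar> \<le> a / 2 * norm y" .
    \<comment> \<open>Half of the exponent \<open>a\<close> dominates the exponential factor, the other half the square of the norm.\<close>
    have "\<bar>exp (\<theta> \<bullet> y) - 1 - \<theta> \<bullet> y\<bar> \<le> (\<theta> \<bullet> y)\<^sup>2 * exp \<bar>\<theta> \<bullet> y\<bar>"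
      by (rule abs_exp_minus_linear_le)
    also have "\<dots> \<le> (norm \<theta> * norm y)\<^sup>2 * exp (a / 2 * norm y)"
      using * ** by (intro mult_mono) (auto simp: abs_le_square_iff[symmetric])
    also have "\<dots> \<le> ((norm \<theta>)\<^sup>2 * (2 / (a / 2)\<^sup>2 * exp (a / 2 * norm y))) * exp (a / 2 * norm y)"
      unfolding power_mult_distrib using a
      by (intro mult_right_mono mult_left_mono power2_le_exp) auto
    also have "\<dots> = (norm \<theta>)\<^sup>2 * (8 / a\<^sup>2 * exp (a * norm y))"
      by (simp add: power_divide flip: exp_add)
    finally show ?thesis .
  qed
  have "((\<lambda>\<theta>. enn2real (laplace \<kappa> \<theta>)) has_derivative (\<lambda>h. v \<bullet> h)) (at 0)"
  proof (rule has_derivativeI_sandwich[where e = "a / 2" and H = "\<lambda>\<theta>. D * norm \<theta>"])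
    fix \<theta> :: "real^2" assume "\<theta> \<noteq> 0" "dist \<theta> 0 < a / 2"
    then have \<theta>: "norm \<theta> \<le> a / 2" by simp
    have i1: "integrable \<kappa> (\<lambda>y. exp (\<theta> \<bullet> y) - 1 - \<theta> \<bullet> y)"
      using a \<theta> by (intro Bochner_Integration.integrable_diff int_exp integrable_inner_right id) auto
    have mean: "v \<bullet> \<theta> = (\<integral>y. \<theta> \<bullet> y \<partial>\<kappa>)"
      using id unfolding v_def by (simp add: inner_commute[of _ \<theta>])
    have "enn2real (laplace \<kappa> \<theta>) - enn2real (laplace \<kappa> 0) - v \<bullet> (\<theta> - 0)
        = (\<integral>y. exp (\<theta> \<bullet> y) - 1 - \<theta> \<bullet> y \<partial>\<kappa>)"
      using a \<theta> id mean by (simp add: laplace_eq int_exp integrable_inner_right)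
    then have "norm (enn2real (laplace \<kappa> \<theta>) - enn2real (laplace \<kappa> 0) - v \<bullet> (\<theta> - 0))
        \<le> (\<integral>y. \<bar>exp (\<theta> \<bullet> y) - 1 - \<theta> \<bullet> y\<bar> \<partial>\<kappa>)"
      using integral_norm_bound[of \<kappa> "\<lambda>y. exp (\<theta> \<bullet> y) - 1 - \<theta> \<bullet> y"] by simp
    also have "\<dots> \<le> (\<integral>y. (norm \<theta>)\<^sup>2 * (8 / a\<^sup>2 * exp (a * norm y)) \<partial>\<kappa>)"
      using int i1 by (intro integral_mono remainder \<theta>) auto
    also have "\<dots> = D * norm \<theta> * norm \<theta>"
      by (simp add: D_def power2_eq_square)
    finally show "norm (enn2real (laplace \<kappa> \<theta>) - enn2real (laplace \<kappa> 0) - v \<bullet> (\<theta> - 0)) / norm (\<theta> - 0)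
        \<le> D * norm \<theta>"
      using \<open>\<theta> \<noteq> 0\<close> by (simp add: divide_le_eq)
  next
    show "((\<lambda>\<theta>. D * norm \<theta>) \<longlongrightarrow> 0) (at (0 :: real^2))"
      by (auto intro!: tendsto_eq_intros)
  qed (use a in \<open>auto intro: bounded_linear_inner_right\<close>)
  then show "drift \<kappa> = (\<integral>y. y \<partial>\<kappa>)"
    unfolding drift_def v_def by (rule grad_eq)
qed

text \<open>The dependence on \<open>r\<close> is what matters: with \<open>r\<close> and \<open>C\<close> both proportional to \<open>N\<close>, the second moment is
  of order \<open>1 / N\<close>.\<close>
lemma
  fixes \<kappa> :: "(real^2) measure"
  assumes sets: "sets \<kappa> = sets borel" and fin: "finite_measure \<kappa>" and r: "r > 0" and C: "C \<ge> 0"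
    and bound: "\<And>\<theta>. norm \<theta> \<le> r \<Longrightarrow> laplace \<kappa> \<theta> \<le> ennreal C"
  shows laplace_bound_integrable_square: "integrable \<kappa> (\<lambda>y. (norm y)\<^sup>2)"
    and laplace_bound_integrable_id: "integrable \<kappa> (\<lambda>y. y)"
    and laplace_bound_second_moment: "(\<integral>y. (norm y)\<^sup>2 \<partial>\<kappa>) \<le> 32 * C / r\<^sup>2"
    and laplace_bound_drift: "drift \<kappa> = (\<integral>y. y \<partial>\<kappa>)"
proof -
  note [measurable_cong] = sets
  have le: "(\<integral>\<^sup>+ y. ennreal (exp (r / 2 * norm y)) \<partial>\<kappa>) \<le> ennreal (4 * C)"
    using exp_norm_integral_le_laplace[OF sets, of "r / 2" "ennreal C"] r C bound
    by (simp add: ennreal_mult)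
  have int: "integrable \<kappa> (\<lambda>y. exp (r / 2 * norm y))"
    by (rule integrableI_nonneg) (use le in \<open>auto intro: order.strict_trans1\<close>)
  have "(\<integral>y. exp (r / 2 * norm y) \<partial>\<kappa>) \<le> 4 * C"
    using le C by (subst integral_eq_nn_integral) (auto intro: enn2real_leI)
  then have *: "2 / (r / 2)\<^sup>2 * (\<integral>y. exp (r / 2 * norm y) \<partial>\<kappa>) \<le> 2 / (r / 2)\<^sup>2 * (4 * C)"
    by (intro mult_left_mono) auto
  show "integrable \<kappa> (\<lambda>y. (norm y)\<^sup>2)" "integrable \<kappa> (\<lambda>y. y)" "drift \<kappa> = (\<integral>y. y \<partial>\<kappa>)"
    using integrable_square_if_exp[OF sets fin _ int] integrable_id_if_exp[OF sets fin _ int]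
      drift_eq_integral[OF sets fin _ int] r by auto
  show "(\<integral>y. (norm y)\<^sup>2 \<partial>\<kappa>) \<le> 32 * C / r\<^sup>2"
    using second_moment_le_exp[OF sets fin _ int] r * by (simp add: power_divide)
qed

section \<open>The law of the next jump given the past\<close>

text \<open>Integrals against a Markov or sub-Markov kernel are measurable in the parameter. Normalising
  carries this over to a finite kernel. Where \<open>K x\<close> vanishes, the normalising factor is infinite, but
  it multiplies the null measure.\<close>
lemma finite_kernel_factor:
  assumes K: "finite_kernel_on D K"
  obtains k where "k \<in> measurable (restrict_space borel D) (subprob_algebra borel)"
    and "\<And>x (f :: real^2 \<Rightarrow> ennreal). x \<in> D \<Longrightarrow> f \<in> borel_measurable borel \<Longrightarrow>
      integral\<^sup>N (K x) f = emeasure (K x) UNIV * integral\<^sup>N (k x) f"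
proof
  define k where "k = (\<lambda>x. scale_measure (inverse (emeasure (K x) UNIV)) (K x))"
  have sets: "sets (K x) = sets borel" and fin: "finite_measure (K x)" if "x \<in> D" for x
    using K that by (auto simp: finite_kernel_on_def)
  have sp: "space (K x) = UNIV" if "x \<in> D" for x
    using sets_eq_imp_space_eq[OF sets[OF that]] by simp
  have meas: "(\<lambda>x. emeasure (K x) A) \<in> borel_measurable (restrict_space borel D)"
    if "A \<in> sets borel" for A
    using K that by (auto simp: finite_kernel_on_def)
  have finE: "emeasure (K x) UNIV < \<top>" if "x \<in> D" for x
    using finite_measure.emeasure_finite[OF fin[OF that], of UNIV] by (simp add: less_top)
  show "k \<in> measurable (restrict_space borel D) (subprob_algebra borel)"
  proof (rule measurable_subprob_algebra)
    fix x assume "x \<in> space (restrict_space borel D :: (real^2) measure)"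
    then have x: "x \<in> D" by (simp add: space_restrict_space)
    show "sets (k x) = sets borel" by (simp add: k_def sets x)
    have "inverse (emeasure (K x) UNIV) * emeasure (K x) UNIV \<le> 1"
      using finE[OF x] by (cases "emeasure (K x) UNIV = 0")
        (auto simp: mult.commute[of "inverse _"] ennreal_divide_self less_top simp flip: divide_ennreal_def)
    then show "subprob_space (k x)"
      by (intro subprob_spaceI) (auto simp: k_def space_scale_measure sp x)
  next
    fix A :: "(real^2) set" assume "A \<in> sets borel"
    then show "(\<lambda>x. emeasure (k x) A) \<in> borel_measurable (restrict_space borel D)"
      using meas by (simp add: k_def)
  qed
  fix x and f :: "real^2 \<Rightarrow> ennreal" assume x: "x \<in> D" and f: "f \<in> borel_measurable borel"
  have f': "f \<in> borel_measurable (K x)" using f by (simp cong: measurable_cong_sets add: sets[OF x])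
  show "integral\<^sup>N (K x) f = emeasure (K x) UNIV * integral\<^sup>N (k x) f"
  proof (cases "emeasure (K x) UNIV = 0")
    case True
    then have "K x = null_measure (K x)"
      using sets[OF x] by (intro measure_eqI) (auto intro: emeasure_eq_0[of UNIV])
    then have "integral\<^sup>N (K x) f = 0" by (metis nn_integral_null_measure)
    then show ?thesis using True by simp
  next
    case False
    then show ?thesis using finE[OF x] unfolding k_def nn_integral_scale_measure[OF f']
      by (simp add: ennreal_divide_self less_top flip: mult.assoc divide_ennreal_def)
  qed
qed

lemma nn_integral_exp_tail:
  fixes q s :: real
  assumes q: "q > 0"
  shows "(\<integral>\<^sup>+ r. indicator {s<..} r * ennreal (exp (- q * r)) \<partial>lborel) = ennreal (exp (- q * s) / q)"
proof -
  have lim: "((\<lambda>r. - exp (- q * r) / q) \<longlongrightarrow> 0) at_top"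
    using q by real_asymp
  have "(\<integral>\<^sup>+ r. indicator {s<..} r * ennreal (exp (- q * r)) \<partial>lborel)
      = (\<integral>\<^sup>+ r. ennreal (exp (- q * r)) * indicator {s..} r \<partial>lborel)"
    using AE_lborel_singleton[of s]
    by (intro nn_integral_cong_AE) (auto elim!: eventually_mono split: split_indicator)
  also have "\<dots> = ennreal (0 - (- exp (- q * s) / q))"
    using q by (intro nn_integral_FTC_atLeast lim) (auto intro!: derivative_eq_intros)
  finally show ?thesis by simp
qed

text \<open>The jump times and states of a pure jump Markov process, detached from its continuous time path.\<close>
locale jump_chain = prob_space M for M :: "'w measure" +
  fixes D :: "(real^2) set" and K :: "real^2 \<Rightarrow> (real^2) measure"
    and J :: "nat \<Rightarrow> 'w \<Rightarrow> ereal" and Y :: "nat \<Rightarrow> 'w \<Rightarrow> real^2"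
  assumes kernel: "finite_kernel_on D K"
    and J_measurable [measurable]: "\<And>n. J n \<in> borel_measurable M"
    and Y_measurable [measurable]: "\<And>n. Y n \<in> borel_measurable M"
    and J_0: "\<And>\<omega>. \<omega> \<in> space M \<Longrightarrow> J 0 \<omega> = 0"
    and Y_in: "\<And>n \<omega>. \<omega> \<in> space M \<Longrightarrow> Y n \<omega> \<in> D"
    and J_le_Suc: "\<And>n \<omega>. \<omega> \<in> space M \<Longrightarrow> J n \<omega> \<le> J (Suc n) \<omega>"
    and J_less_Suc: "\<And>n \<omega>. \<omega> \<in> space M \<Longrightarrow> J n \<omega> < \<infinity> \<Longrightarrow> J n \<omega> < J (Suc n) \<omega>"
    and jump_law: "\<And>n s B. 0 \<le> s \<Longrightarrow> B \<in> sets borel \<Longrightarrow> AE \<omega> in M.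
           real_cond_exp M (jump_history M J Y n)
             (indicator {\<omega> \<in> space M. J n \<omega> + ereal s < J (Suc n) \<omega> \<and> J (Suc n) \<omega> < \<infinity> \<and>
                                      Y (Suc n) \<omega> - Y n \<omega> \<in> B}) \<omega> =
           (if J n \<omega> = \<infinity> then 0
            else exp (- measure (K (Y n \<omega>)) UNIV * s) *
                 (measure (K (Y n \<omega>)) B / measure (K (Y n \<omega>)) UNIV))"
begin

abbreviation rate :: "real^2 \<Rightarrow> real" where
  "rate x \<equiv> measure (K x) UNIV"

text \<open>Jump times as real numbers; a jump that never happens gets the value \<open>0\<close>, so this is only meaningful where
  \<open>J n\<close> is finite.\<close>
definition clock :: "nat \<Rightarrow> 'w \<Rightarrow> real" where
  "clock n \<omega> = real_of_ereal (J n \<omega>)"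

lemma clock_measurable [measurable]: "clock n \<in> borel_measurable M"
  unfolding clock_def by measurable

lemma J_mono: "\<omega> \<in> space M \<Longrightarrow> m \<le> n \<Longrightarrow> J m \<omega> \<le> J n \<omega>"
  by (rule lift_Suc_mono_le[of "\<lambda>n. J n \<omega>"]) (auto intro: J_le_Suc)

lemma J_eq_clock: "\<omega> \<in> space M \<Longrightarrow> J n \<omega> < \<infinity> \<Longrightarrow> J n \<omega> = ereal (clock n \<omega>)"
  using J_mono[of \<omega> 0 n] J_0[of \<omega>] by (cases "J n \<omega>") (auto simp: clock_def)

lemma clock_nonneg: "\<omega> \<in> space M \<Longrightarrow> 0 \<le> clock n \<omega>"
  using J_mono[of \<omega> 0 n] J_0[of \<omega>] by (auto simp: clock_def real_of_ereal_pos)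

lemma kernel_sets: "x \<in> D \<Longrightarrow> sets (K x) = sets borel"
  and kernel_finite: "x \<in> D \<Longrightarrow> finite_measure (K x)"
  using kernel by (auto simp: finite_kernel_on_def)

lemma emeasure_kernel: "x \<in> D \<Longrightarrow> emeasure (K x) A = ennreal (measure (K x) A)"
  using finite_measure.emeasure_eq_measure[OF kernel_finite] by blast

lemma Y_measurable_restrict [measurable]: "Y n \<in> measurable M (restrict_space borel D)"
  using Y_in by (intro measurable_restrict_space2) auto

lemma emeasure_kernel_Y_measurable [measurable]:
  assumes "B \<in> sets borel"
  shows "(\<lambda>\<omega>. emeasure (K (Y n \<omega>)) B) \<in> borel_measurable M"
  using kernel assms
  by (intro measurable_compose[OF Y_measurable_restrict[of n]]) (auto simp: finite_kernel_on_def)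

lemma measure_kernel_Y_measurable [measurable]:
  "B \<in> sets borel \<Longrightarrow> (\<lambda>\<omega>. measure (K (Y n \<omega>)) B) \<in> borel_measurable M"
  using measurable_compose[OF emeasure_kernel_Y_measurable, of B enn2real borel n]
  by (simp add: measure_def)

abbreviation history :: "nat \<Rightarrow> 'w measure" where
  "history n \<equiv> jump_history M J Y n"

lemma space_history [simp]: "space (history n) = space M"
  by (simp add: jump_history_def)

lemma pairs_measurable_history:
  "(\<lambda>\<omega>. \<lambda>k\<in>{..n}. (J k \<omega>, Y k \<omega>)) \<in> measurable (history n) (Pi\<^sub>M {..n} (\<lambda>_. borel \<Otimes>\<^sub>M borel))"
  unfolding jump_history_def by (rule measurable_vimage_algebra1) (auto simp: space_PiM space_pair_measure)

lemma J_Y_measurable_history: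
  assumes "k \<le> n"
  shows "J k \<in> borel_measurable (history n)" "Y k \<in> borel_measurable (history n)"
proof -
  have "(\<lambda>\<omega>. (\<lambda>k\<in>{..n}. (J k \<omega>, Y k \<omega>)) k) \<in> measurable (history n) (borel \<Otimes>\<^sub>M borel)"
    using assms by (intro measurable_compose[OF pairs_measurable_history measurable_component_singleton]) auto
  then have *: "(\<lambda>\<omega>. (J k \<omega>, Y k \<omega>)) \<in> measurable (history n) (borel \<Otimes>\<^sub>M borel)"
    using assms by simp
  show "J k \<in> borel_measurable (history n)" "Y k \<in> borel_measurable (history n)"
    using measurable_compose[OF * measurable_fst] measurable_compose[OF * measurable_snd] by simp_all
qed

lemma history_subalgebra: "subalgebra M (history n)"
proof -
  have "(\<lambda>\<omega>. \<lambda>k\<in>{..n}. (J k \<omega>, Y k \<omega>)) \<in> measurable M (Pi\<^sub>M {..n} (\<lambda>_. borel \<Otimes>\<^sub>M borel))"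
    by measurable
  then have "(\<lambda>\<omega>. \<omega>) \<in> measurable M (history n)"
    unfolding jump_history_def by (intro measurable_vimage_algebra2) auto
  note sub = measurable_sets[OF this]
  have "A \<in> sets M" if A: "A \<in> sets (history n)" for A
    using sub[OF A] sets.sets_into_space[OF A] by (simp add: Int_absorb2)
  then show ?thesis
    by (auto simp: subalgebra_def)
qed

sublocale history: sigma_finite_subalgebra M "history n" for n
  by (rule finite_measure_subalgebra_is_sigma_finite)
    (simp add: finite_measure_subalgebra_def finite_measure_subalgebra_axioms_def
      history_subalgebra finite_measure_axioms)

lemma measurable_if_history: "Z \<in> measurable (history n) T \<Longrightarrow> Z \<in> measurable M T"
  by (rule measurable_from_subalg[OF history_subalgebra])

text \<open>Here \<open>Z\<close> collects whatever is remembered of the past. Integrating the conditional probability over the event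
  \<open>Z \<in> A\<close> gives the joint law of past, holding time and jump on rectangles.\<close>
lemma next_jump_rectangle:
  assumes Z: "Z \<in> measurable (history n) T" and A: "A \<in> sets T"
    and s: "0 \<le> s" and B [measurable]: "B \<in> sets borel"
  shows "emeasure M {\<omega> \<in> space M. Z \<omega> \<in> A \<and> J n \<omega> + ereal s < J (Suc n) \<omega> \<and> J (Suc n) \<omega> < \<infinity> \<and>
           Y (Suc n) \<omega> - Y n \<omega> \<in> B}
       = (\<integral>\<^sup>+ \<omega>. indicator A (Z \<omega>) * ennreal (if J n \<omega> = \<infinity> then 0
            else exp (- rate (Y n \<omega>) * s) * (measure (K (Y n \<omega>)) B / rate (Y n \<omega>))) \<partial>M)"
proof -
  define E where "E = {\<omega> \<in> space M. J n \<omega> + ereal s < J (Suc n) \<omega> \<and> J (Suc n) \<omega> < \<infinity> \<and>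
           Y (Suc n) \<omega> - Y n \<omega> \<in> B}"
  define g where "g \<omega> = (if J n \<omega> = \<infinity> then 0
            else exp (- rate (Y n \<omega>) * s) * (measure (K (Y n \<omega>)) B / rate (Y n \<omega>)))" for \<omega>
  define F where "F = Z -` A \<inter> space M"
  have F: "F \<in> sets (history n)"
    using measurable_sets[OF Z A] by (simp add: F_def)
  have [measurable]: "E \<in> sets M" unfolding E_def by measurable
  have [measurable]: "F \<in> sets M" using F history_subalgebra by (auto simp: subalgebra_def)
  have [measurable]: "g \<in> borel_measurable M" unfolding g_def by measurable
  have g0: "g \<omega> \<ge> 0" for \<omega> by (simp add: g_def)
  have ae: "AE \<omega> in M. real_cond_exp M (history n) (indicator E) \<omega> = g \<omega>"
    using jump_law[OF s B, of n] by (simp add: E_def g_def)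
  have int: "integrable M (indicator E :: 'w \<Rightarrow> real)"
    by (rule integrable_real_indicator) (simp_all add: emeasure_eq_measure)
  have ig: "integrable M g"
    using history.real_cond_exp_int(1)[OF int] ae by (subst integrable_cong_AE[symmetric]) auto
  have "measure M (F \<inter> E) = (\<integral>\<omega>\<in>F. indicator E \<omega> \<partial>M)"
    by (simp add: set_lebesgue_integral_def flip: indicator_inter_arith)
  also have "\<dots> = (\<integral>\<omega>\<in>F. real_cond_exp M (history n) (indicator E) \<omega> \<partial>M)"
    by (rule history.real_cond_exp_intA[OF int F])
  also have "\<dots> = (\<integral>\<omega>. indicator F \<omega> * g \<omega> \<partial>M)"
    unfolding set_lebesgue_integral_def using ae by (intro integral_cong_AE) auto
  finally have "emeasure M (F \<inter> E) = ennreal (\<integral>\<omega>. indicator F \<omega> * g \<omega> \<partial>M)"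
    by (simp add: emeasure_eq_measure)
  also have "\<dots> = (\<integral>\<^sup>+\<omega>. ennreal (indicator F \<omega> * g \<omega>) \<partial>M)"
    using integrable_real_mult_indicator[OF \<open>F \<in> sets M\<close> ig]
    by (intro nn_integral_eq_integral[symmetric]) (auto simp: g0 mult.commute)
  also have "\<dots> = (\<integral>\<^sup>+\<omega>. indicator A (Z \<omega>) * ennreal (g \<omega>) \<partial>M)"
    by (intro nn_integral_cong) (auto simp: F_def split: split_indicator)
  also have "F \<inter> E = {\<omega> \<in> space M. Z \<omega> \<in> A \<and> J n \<omega> + ereal s < J (Suc n) \<omega> \<and> J (Suc n) \<omega> < \<infinity> \<and>
           Y (Suc n) \<omega> - Y n \<omega> \<in> B}"
    by (auto simp: F_def E_def)
  finally show ?thesis by (simp add: g_def)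
qed

end

lemma ex_minus_real_less: "\<exists>i::nat. - real i < x"
  using reals_Archimedean2[of "- x"] by (auto simp: minus_less_iff)

text \<open>The conditional law is prescribed on half-lines of holding times, so those are the rectangles that have to
  generate the product.\<close>
lemma sets_pair_greaterThan:
  "sets (T \<Otimes>\<^sub>M ((borel :: real measure) \<Otimes>\<^sub>M (borel :: (real^2) measure)))
    = sigma_sets (space T \<times> UNIV)
        {A \<times> ({s<..} \<times> B) | A s B. A \<in> sets T \<and> B \<in> sets borel}"
proof -
  define G where "G = {S \<times> B | S B. S \<in> range (greaterThan :: real \<Rightarrow> _) \<and> B \<in> sets (borel :: (real^2) measure)}"
  define C where "C = range (\<lambda>i::nat. {- real i<..})"
  have C: "countable C" "C \<subseteq> range greaterThan" "\<Union> C = UNIV"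
    using ex_minus_real_less by (auto simp: C_def)
  have "sets ((borel :: real measure) \<Otimes>\<^sub>M (borel :: (real^2) measure))
      = sets (sigma (space borel \<times> space borel) G)"
    unfolding G_def
  proof (rule sets_pair_eq[where Ca = C and Cb = "{UNIV}"])
    show "sets (borel :: real measure) = sigma_sets (space borel) (range greaterThan)"
      unfolding borel_Ioi by simp
    show "sets (borel :: (real^2) measure) = sigma_sets (space borel) (sets borel)"
      by (metis sets.sigma_sets_eq)
  qed (use C in auto)
  also have "\<dots> = sigma_sets UNIV G" by simp
  finally have inner: "sets ((borel :: real measure) \<Otimes>\<^sub>M (borel :: (real^2) measure)) = sigma_sets UNIV G" .
  have sp: "space ((borel :: real measure) \<Otimes>\<^sub>M (borel :: (real^2) measure)) = UNIV"
    by (simp add: space_pair_measure)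
  have "sets (T \<Otimes>\<^sub>M ((borel :: real measure) \<Otimes>\<^sub>M (borel :: (real^2) measure)))
     = sets (sigma (space T \<times> space (borel \<Otimes>\<^sub>M borel)) {a \<times> b | a b. a \<in> sets T \<and> b \<in> G})"
  proof (rule sets_pair_eq[where Ca = "{space T}" and Cb = "(\<lambda>S. S \<times> UNIV) ` C"])
    show "sets T = sigma_sets (space T) (sets T)" by (simp add: sets.sigma_sets_eq)
    show "sets (borel \<Otimes>\<^sub>M borel) = sigma_sets (space (borel \<Otimes>\<^sub>M borel)) G"
      unfolding sp inner ..
    show "(\<lambda>S. S \<times> UNIV) ` C \<subseteq> G"
    proof (rule image_subsetI)
      fix S assume "S \<in> C"
      then have "S \<in> range greaterThan" using C(2) by (rule subsetD[rotated])
      then show "S \<times> UNIV \<in> G"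
        unfolding G_def by (intro CollectI exI[of _ S] exI[of _ UNIV]) simp
    qed
    show "\<Union> ((\<lambda>S. S \<times> UNIV) ` C) = space ((borel :: real measure) \<Otimes>\<^sub>M (borel :: (real^2) measure))"
      unfolding sp using C(3) by auto
  qed (use C sets.sets_into_space[of _ T] in \<open>auto simp: sp\<close>)
  also have "\<dots> = sigma_sets (space T \<times> UNIV) {a \<times> b | a b. a \<in> sets T \<and> b \<in> G}"
    unfolding sp by (rule sets_measure_of) (use sets.sets_into_space[of _ T] in auto)
  also have "{a \<times> b | a b. a \<in> sets T \<and> b \<in> G}
      = {A \<times> ({s<..} \<times> B) | A s B. A \<in> sets T \<and> B \<in> sets borel}"
  proof (intro equalityI subsetI)
    fix X assume "X \<in> {a \<times> b | a b. a \<in> sets T \<and> b \<in> G}"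
    then obtain A b where X: "X = A \<times> b" "A \<in> sets T" "b \<in> G" by (elim CollectE exE conjE)
    then obtain s B where "b = {s<..} \<times> B" "B \<in> sets borel"
      unfolding G_def by (elim CollectE exE conjE imageE) simp
    then show "X \<in> {A \<times> ({s<..} \<times> B) | A s B. A \<in> sets T \<and> B \<in> sets borel}"
      using X by (intro CollectI exI[of _ A] exI[of _ s] exI[of _ B]) simp
  next
    fix X assume "X \<in> {A \<times> ({s<..} \<times> B) | A (s :: real) B. A \<in> sets T \<and> B \<in> sets (borel :: (real^2) measure)}"
    then obtain A B and s :: real where X: "X = A \<times> ({s<..} \<times> B)" "A \<in> sets T" "B \<in> sets borel"
      by (elim CollectE exE conjE)
    then have "{s<..} \<times> B \<in> G"
      unfolding G_def by (intro CollectI exI[of _ "{s<..}"] exI[of _ B]) simp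
    then show "X \<in> {a \<times> b | a b. a \<in> sets T \<and> b \<in> G}"
      using X by (intro CollectI exI[of _ A] exI[of _ "{s<..} \<times> B"]) simp
  qed
  finally show ?thesis .
qed

context jump_chain
begin

text \<open>The Markov property in the form used below: given the past and a finite current jump time, the holding time has density
  \<open>q exp (- q r)\<close> and the jump has law \<open>K / q\<close>, independently. Here the factor \<open>q\<close> of the density cancels the
  normalisation of the kernel, so the formula also covers absorbing states, where both sides give no mass to
  a further jump. Both sides integrate \<open>f\<close> against finite measures, which agree on rectangles by
  \<open>next_jump_rectangle\<close>.\<close>
lemma nn_integral_next_jump:
  fixes f :: "'t \<times> real \<times> (real^2) \<Rightarrow> ennreal"
  assumes Z: "Z \<in> measurable (history n) T"
    and f [measurable]: "f \<in> borel_measurable (T \<Otimes>\<^sub>M borel \<Otimes>\<^sub>M borel)"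
  shows "(\<integral>\<^sup>+ \<omega>. indicator {\<omega>. J (Suc n) \<omega> < \<infinity>} \<omega> *
            f (Z \<omega>, clock (Suc n) \<omega> - clock n \<omega>, Y (Suc n) \<omega> - Y n \<omega>) \<partial>M)
       = (\<integral>\<^sup>+ \<omega>. indicator {\<omega>. J n \<omega> < \<infinity>} \<omega> *
            (\<integral>\<^sup>+ r. indicator {0<..} r * ennreal (exp (- rate (Y n \<omega>) * r)) *
               (\<integral>\<^sup>+ \<xi>. f (Z \<omega>, r, \<xi>) \<partial>K (Y n \<omega>)) \<partial>lborel) \<partial>M)"
proof -
  obtain k where k: "k \<in> measurable (restrict_space borel D) (subprob_algebra borel)"
    and K_eq: "\<And>x (f :: real^2 \<Rightarrow> ennreal). x \<in> D \<Longrightarrow> f \<in> borel_measurable borel \<Longrightarrow>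
      integral\<^sup>N (K x) f = emeasure (K x) UNIV * integral\<^sup>N (k x) f"
    using finite_kernel_factor[OF kernel] by blast
  have kY [measurable]: "(\<lambda>\<omega>. k (Y n \<omega>)) \<in> measurable M (subprob_algebra borel)"
    by (rule measurable_compose[OF Y_measurable_restrict k])
  have [measurable]: "Z \<in> measurable M T" by (rule measurable_if_history[OF Z])
  let ?N = "T \<Otimes>\<^sub>M ((borel :: real measure) \<Otimes>\<^sub>M (borel :: (real^2) measure))"
  define R where "R \<omega> = emeasure (K (Y n \<omega>)) UNIV" for \<omega>
  have [measurable]: "R \<in> borel_measurable M" unfolding R_def by measurable
  define g where "g \<omega> r = indicator {\<omega>. J n \<omega> < \<infinity>} \<omega> * (indicator {0<..} r *
      ennreal (exp (- rate (Y n \<omega>) * r)) * R \<omega>)" for \<omega> and r :: real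
  have g [measurable]: "(\<lambda>(\<omega>, r). g \<omega> r) \<in> borel_measurable (M \<Otimes>\<^sub>M lborel)"
    unfolding g_def by measurable
  \<comment> \<open>The right hand side is integration against \<open>M \<bind> \<kappa>\<close>, with \<open>\<kappa> \<omega>\<close> the conditional law of past, holding
    time and jump.\<close>
  define \<kappa> where "\<kappa> \<omega> = distr (density (lborel \<Otimes>\<^sub>M k (Y n \<omega>)) (\<lambda>w. g \<omega> (fst w))) ?N
      (Pair (Z \<omega>))" for \<omega>
  have sub: "subprob_space (k (Y n \<omega>))" and setsk: "sets (k (Y n \<omega>)) = sets borel"
    if "\<omega> \<in> space M" for \<omega>
    using measurable_space[OF kY that] by (auto simp: space_subprob_algebra)
  have \<kappa>_int: "(\<integral>\<^sup>+ z. h z \<partial>\<kappa> \<omega>) = (\<integral>\<^sup>+ r. g \<omega> r * (\<integral>\<^sup>+ \<xi>. h (Z \<omega>, r, \<xi>) \<partial>k (Y n \<omega>)) \<partial>lborel)"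
    if \<omega>: "\<omega> \<in> space M" and h [measurable]: "h \<in> borel_measurable ?N" for \<omega> h
  proof -
    note [measurable_cong] = setsk[OF \<omega>]
    interpret k: subprob_space "k (Y n \<omega>)" by (rule sub[OF \<omega>])
    have [measurable]: "Z \<omega> \<in> space T" using measurable_space[OF measurable_if_history[OF Z] \<omega>] .
    have [measurable]: "g \<omega> \<in> borel_measurable lborel" unfolding g_def by measurable
    have P: "Pair (Z \<omega>) \<in> measurable (lborel \<Otimes>\<^sub>M k (Y n \<omega>)) ?N"
      unfolding measurable_cong_sets[OF sets_pair_measure_cong[OF sets_lborel setsk[OF \<omega>]] refl]
      using \<open>Z \<omega> \<in> space T\<close> by (rule measurable_Pair1')
    have G: "(\<lambda>w. g \<omega> (fst w)) \<in> borel_measurable (lborel \<Otimes>\<^sub>M k (Y n \<omega>))"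
      by measurable
    have H: "(\<lambda>w. h (Z \<omega>, w)) \<in> borel_measurable (lborel \<Otimes>\<^sub>M k (Y n \<omega>))"
      by (rule measurable_compose[OF P h])
    have H_section: "(\<lambda>\<xi>. h (Z \<omega>, r, \<xi>)) \<in> borel_measurable (k (Y n \<omega>))" for r
      by (rule measurable_compose[OF measurable_Pair1' H]) simp
    have "(\<integral>\<^sup>+ z. h z \<partial>\<kappa> \<omega>)
        = (\<integral>\<^sup>+ w. h (Z \<omega>, w) \<partial>density (lborel \<Otimes>\<^sub>M k (Y n \<omega>)) (\<lambda>w. g \<omega> (fst w)))"
      unfolding \<kappa>_def using P by (intro nn_integral_distr) auto
    also have "\<dots> = (\<integral>\<^sup>+ w. g \<omega> (fst w) * h (Z \<omega>, w) \<partial>(lborel \<Otimes>\<^sub>M k (Y n \<omega>)))"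
      by (intro nn_integral_density G H)
    also have "\<dots> = (\<integral>\<^sup>+ r. (\<integral>\<^sup>+ \<xi>. g \<omega> r * h (Z \<omega>, r, \<xi>) \<partial>k (Y n \<omega>)) \<partial>lborel)"
      using k.nn_integral_fst[OF borel_measurable_times_ennreal[OF G H]] by simp
    also have "\<dots> = (\<integral>\<^sup>+ r. g \<omega> r * (\<integral>\<^sup>+ \<xi>. h (Z \<omega>, r, \<xi>) \<partial>k (Y n \<omega>)) \<partial>lborel)"
      by (intro nn_integral_cong nn_integral_cmult H_section)
    finally show ?thesis .
  qed
  have tail: "(\<integral>\<^sup>+ r. g \<omega> r * indicator {s<..} r \<partial>lborel) = ennreal (if J n \<omega> = \<infinity> then 0
      else exp (- rate (Y n \<omega>) * s) * (rate (Y n \<omega>) / rate (Y n \<omega>)))"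
    if \<omega>: "\<omega> \<in> space M" and s: "s \<ge> 0" for \<omega> s
  proof (cases "J n \<omega> = \<infinity> \<or> rate (Y n \<omega>) = 0")
    case True
    then show ?thesis using \<omega> by (auto simp: g_def R_def emeasure_kernel Y_in)
  next
    case False
    then have q: "rate (Y n \<omega>) > 0" by (simp add: less_le)
    have "(\<integral>\<^sup>+ r. g \<omega> r * indicator {s<..} r \<partial>lborel)
        = (\<integral>\<^sup>+ r. R \<omega> * (indicator {s<..} r * ennreal (exp (- rate (Y n \<omega>) * r))) \<partial>lborel)"
      using False s by (intro nn_integral_cong) (auto simp: g_def mult.commute split: split_indicator)
    also have "\<dots> = R \<omega> * ennreal (exp (- rate (Y n \<omega>) * s) / rate (Y n \<omega>))"
      by (subst nn_integral_cmult) (use nn_integral_exp_tail[OF q, of s] in auto)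
    also have "\<dots> = ennreal (exp (- rate (Y n \<omega>) * s))"
      using q \<omega> by (simp add: R_def emeasure_kernel Y_in flip: ennreal_mult)
    finally show ?thesis using False by simp
  qed
  have \<kappa>_measurable: "\<kappa> \<in> measurable M (subprob_algebra ?N)"
  proof (rule measurable_subprob_algebra)
    fix \<omega> assume \<omega>: "\<omega> \<in> space M"
    show "sets (\<kappa> \<omega>) = sets ?N" by (simp add: \<kappa>_def)
    interpret k: subprob_space "k (Y n \<omega>)" by (rule sub[OF \<omega>])
    have "emeasure (\<kappa> \<omega>) (space (\<kappa> \<omega>)) = (\<integral>\<^sup>+ z. 1 \<partial>\<kappa> \<omega>)" by simp
    also have "\<dots> = (\<integral>\<^sup>+ r. g \<omega> r * emeasure (k (Y n \<omega>)) (space (k (Y n \<omega>))) \<partial>lborel)"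
      using \<kappa>_int[OF \<omega>, of "\<lambda>_. 1"] by simp
    also have "\<dots> \<le> (\<integral>\<^sup>+ r. g \<omega> r * indicator {0<..} r \<partial>lborel)"
      using k.emeasure_space_le_1
      by (intro nn_integral_mono) (auto simp: g_def split: split_indicator intro: mult_left_le)
    also have "\<dots> \<le> 1"
      unfolding tail[OF \<omega> order_refl] by (simp add: ennreal_le_1)
    finally show "subprob_space (\<kappa> \<omega>)"
      using measurable_space[OF measurable_if_history[OF Z] \<omega>]
      by (intro subprob_spaceI) (auto simp: \<kappa>_def space_pair_measure)
  next
    fix A assume A [measurable]: "A \<in> sets ?N"
    have "(\<lambda>\<omega>. \<integral>\<^sup>+ r. g \<omega> r * (\<integral>\<^sup>+ \<xi>. indicator A (Z \<omega>, r, \<xi>) \<partial>k (Y n \<omega>)) \<partial>lborel) \<in> borel_measurable M"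
    proof (rule lborel.borel_measurable_nn_integral)
      have "(\<lambda>p. \<integral>\<^sup>+ \<xi>. indicator A (Z (fst p), snd p, \<xi>) \<partial>k (Y n (fst p)))
          \<in> borel_measurable (M \<Otimes>\<^sub>M lborel)"
        by (rule nn_integral_measurable_subprob_algebra2[where N = borel]) measurable
      then show "(\<lambda>(\<omega>, r). g \<omega> r * (\<integral>\<^sup>+ \<xi>. indicator A (Z \<omega>, r, \<xi>) \<partial>k (Y n \<omega>)))
          \<in> borel_measurable (M \<Otimes>\<^sub>M lborel)"
        using g by (simp add: case_prod_beta)
    qed
    then show "(\<lambda>\<omega>. emeasure (\<kappa> \<omega>) A) \<in> borel_measurable M"
      by (rule measurable_cong[THEN iffD1, rotated])
        (use \<kappa>_int[of _ "indicator A"] in \<open>auto simp: \<kappa>_def\<close>)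
  qed
  define W where "W \<omega> = (Z \<omega>, clock (Suc n) \<omega> - clock n \<omega>, Y (Suc n) \<omega> - Y n \<omega>)" for \<omega>
  have [measurable]: "W \<in> measurable M ?N" unfolding W_def by measurable
  define \<nu> where "\<nu> = distr (density M (indicator {\<omega> \<in> space M. J (Suc n) \<omega> < \<infinity>})) ?N W"
  have emeasure_\<nu>: "emeasure \<nu> X = emeasure M {\<omega> \<in> space M. J (Suc n) \<omega> < \<infinity> \<and> W \<omega> \<in> X}"
    if [measurable]: "X \<in> sets ?N" for X
    unfolding \<nu>_def by (simp add: emeasure_distr emeasure_density emeasure_restricted Int_def
        vimage_def conj_commute conj_left_commute flip: indicator_inter_arith)
  have "\<nu> = M \<bind> \<kappa>"
  proof (rule measure_eqI_generator_eq)
    let ?E = "{A \<times> ({s<..} \<times> B) | A (s :: real) (B :: (real^2) set). A \<in> sets T \<and> B \<in> sets borel}"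
    show "Int_stable ?E"
    proof (rule Int_stableI, clarsimp)
      fix A A' :: "'t set" and B B' :: "(real^2) set" and s s' :: real
      assume "A \<in> sets T" "A' \<in> sets T" "B \<in> sets borel" "B' \<in> sets borel"
      moreover have "A \<times> {s<..} \<times> B \<inter> A' \<times> {s'<..} \<times> B' = (A \<inter> A') \<times> {max s s'<..} \<times> (B \<inter> B')"
        by auto
      ultimately show "\<exists>A'' s'' B''. A \<times> {s<..} \<times> B \<inter> A' \<times> {s'<..} \<times> B' = A'' \<times> {s''<..} \<times> B'' \<and>
          A'' \<in> sets T \<and> B'' \<in> sets borel"
        by blast
    qed
    show "?E \<subseteq> Pow (space T \<times> UNIV)" using sets.sets_into_space[of _ T] by auto
    show "sets \<nu> = sigma_sets (space T \<times> UNIV) ?E"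
      by (simp add: \<nu>_def sets_pair_greaterThan)
    show "sets (M \<bind> \<kappa>) = sigma_sets (space T \<times> UNIV) ?E"
      using sets_bind[of M \<kappa> ?N] by (simp add: \<kappa>_def sets_pair_greaterThan not_empty)
    show "range (\<lambda>i::nat. space T \<times> ({- real i<..} \<times> UNIV)) \<subseteq> ?E"
      by (intro image_subsetI CollectI exI[of _ "space T"] exI[of _ "- real _"] exI[of _ UNIV]) auto
    show "(\<Union>i::nat. space T \<times> ({- real i<..} \<times> UNIV)) = space T \<times> UNIV"
      using ex_minus_real_less by auto
    show "emeasure \<nu> (space T \<times> ({- real i<..} \<times> UNIV)) \<noteq> \<infinity>" for i
      by (subst emeasure_\<nu>) auto
    fix X assume "X \<in> ?E"
    then obtain A B and s :: real where X: "X = A \<times> ({s<..} \<times> B)"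
      and A [measurable]: "A \<in> sets T" and B [measurable]: "B \<in> sets borel" by blast
    have XN: "X \<in> sets ?N" unfolding X by measurable
    \<comment> \<open>Holding times are positive, so a negative threshold is as good as zero.\<close>
    define s' where "s' = max s 0"
    have "emeasure \<nu> X = emeasure M {\<omega> \<in> space M. Z \<omega> \<in> A \<and> J n \<omega> + ereal s' < J (Suc n) \<omega> \<and>
        J (Suc n) \<omega> < \<infinity> \<and> Y (Suc n) \<omega> - Y n \<omega> \<in> B}"
      unfolding emeasure_\<nu>[OF XN]
    proof (rule arg_cong[where f = "emeasure M"], rule Collect_cong)
      fix \<omega>
      have "s < clock (Suc n) \<omega> - clock n \<omega> \<longleftrightarrow> J n \<omega> + ereal s' < J (Suc n) \<omega>"
        if \<omega>: "\<omega> \<in> space M" and fin: "J (Suc n) \<omega> < \<infinity>"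
      proof -
        have "J n \<omega> < \<infinity>" using J_le_Suc[OF \<omega>] fin by (rule order.strict_trans1)
        then show ?thesis
          using J_eq_clock[OF \<omega> fin] J_eq_clock[OF \<omega>, of n] J_less_Suc[OF \<omega>, of n]
          by (cases "s \<le> 0") (auto simp: s'_def max_absorb1 max_absorb2)
      qed
      then show "(\<omega> \<in> space M \<and> J (Suc n) \<omega> < \<infinity> \<and> W \<omega> \<in> X) \<longleftrightarrow>
        (\<omega> \<in> space M \<and> Z \<omega> \<in> A \<and> J n \<omega> + ereal s' < J (Suc n) \<omega> \<and>
          J (Suc n) \<omega> < \<infinity> \<and> Y (Suc n) \<omega> - Y n \<omega> \<in> B)"
        by (auto simp: W_def X)
    qed
    also have "\<dots> = (\<integral>\<^sup>+ \<omega>. indicator A (Z \<omega>) * ennreal (if J n \<omega> = \<infinity> then 0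
            else exp (- rate (Y n \<omega>) * s') * (measure (K (Y n \<omega>)) B / rate (Y n \<omega>))) \<partial>M)"
      by (rule next_jump_rectangle[OF Z A _ B]) (simp add: s'_def)
    also have "\<dots> = (\<integral>\<^sup>+ \<omega>. emeasure (\<kappa> \<omega>) X \<partial>M)"
    proof (rule nn_integral_cong)
      fix \<omega> assume \<omega>: "\<omega> \<in> space M"
      have "emeasure (\<kappa> \<omega>) X = (\<integral>\<^sup>+ z. indicator X z \<partial>\<kappa> \<omega>)"
        using XN by (simp add: \<kappa>_def)
      also have "\<dots> = (\<integral>\<^sup>+ r. g \<omega> r * (\<integral>\<^sup>+ \<xi>. indicator X (Z \<omega>, r, \<xi>) \<partial>k (Y n \<omega>)) \<partial>lborel)"
        using XN by (intro \<kappa>_int[OF \<omega>]) simp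
      also have "\<dots> = (\<integral>\<^sup>+ r. (indicator A (Z \<omega>) * emeasure (k (Y n \<omega>)) B) * (g \<omega> r * indicator {s'<..} r) \<partial>lborel)"
      proof (intro nn_integral_cong)
        fix r :: real
        have "(\<integral>\<^sup>+ \<xi>. indicator X (Z \<omega>, r, \<xi>) \<partial>k (Y n \<omega>))
            = (\<integral>\<^sup>+ \<xi>. (indicator A (Z \<omega>) * indicator {s<..} r) * indicator B \<xi> \<partial>k (Y n \<omega>))"
          by (intro nn_integral_cong) (auto simp: X split: split_indicator)
        also have "\<dots> = indicator A (Z \<omega>) * indicator {s<..} r * emeasure (k (Y n \<omega>)) B"
          using B by (intro nn_integral_cmult_indicator) (simp add: setsk[OF \<omega>])
        finally show "g \<omega> r * (\<integral>\<^sup>+ \<xi>. indicator X (Z \<omega>, r, \<xi>) \<partial>k (Y n \<omega>)) =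
            (indicator A (Z \<omega>) * emeasure (k (Y n \<omega>)) B) * (g \<omega> r * indicator {s'<..} r)"
          by (auto simp: g_def s'_def mult_ac split: split_indicator)
      qed
      also have "\<dots> = indicator A (Z \<omega>) * emeasure (k (Y n \<omega>)) B * (\<integral>\<^sup>+ r. g \<omega> r * indicator {s'<..} r \<partial>lborel)"
        using \<omega> unfolding g_def by (intro nn_integral_cmult) auto
      also have "\<dots> = indicator A (Z \<omega>) * ennreal (if J n \<omega> = \<infinity> then 0
            else exp (- rate (Y n \<omega>) * s') * (measure (K (Y n \<omega>)) B / rate (Y n \<omega>)))"
      proof (cases "J n \<omega> = \<infinity> \<or> rate (Y n \<omega>) = 0")
        case True
        then show ?thesis using tail[OF \<omega>, of s'] by (auto simp: s'_def)
      next
        case False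
        then have q: "rate (Y n \<omega>) > 0" by (simp add: less_le)
        have "ennreal (measure (K (Y n \<omega>)) B) = ennreal (rate (Y n \<omega>)) * emeasure (k (Y n \<omega>)) B"
          using K_eq[OF Y_in[OF \<omega>], of "indicator B" n] B setsk[OF \<omega>] kernel_sets[OF Y_in[OF \<omega>]] \<omega>
          by (simp add: emeasure_kernel Y_in)
        then have "ennreal (inverse (rate (Y n \<omega>))) * ennreal (measure (K (Y n \<omega>)) B)
            = ennreal (inverse (rate (Y n \<omega>))) * ennreal (rate (Y n \<omega>)) * emeasure (k (Y n \<omega>)) B"
          by (simp add: mult.assoc)
        also have "ennreal (inverse (rate (Y n \<omega>))) * ennreal (rate (Y n \<omega>)) = 1"
          using q by (simp flip: ennreal_mult)
        finally have "emeasure (k (Y n \<omega>)) B = ennreal (measure (K (Y n \<omega>)) B / rate (Y n \<omega>))"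
          by (simp add: divide_inverse mult.commute flip: ennreal_mult)
        then have "ennreal (exp (- rate (Y n \<omega>) * s') * (measure (K (Y n \<omega>)) B / rate (Y n \<omega>)))
            = ennreal (exp (- rate (Y n \<omega>) * s')) * emeasure (k (Y n \<omega>)) B"
          by (simp only: ennreal_mult exp_ge_zero divide_nonneg_nonneg measure_nonneg)
        moreover have "(\<integral>\<^sup>+ r. g \<omega> r * indicator {s'<..} r \<partial>lborel)
            = ennreal (exp (- rate (Y n \<omega>) * s'))"
          using tail[OF \<omega>, of s'] False by (simp add: s'_def)
        ultimately show ?thesis using False
          by (simp only: de_Morgan_disj if_False simp_thms mult_ac)
      qed
      finally show "indicator A (Z \<omega>) * ennreal (if J n \<omega> = \<infinity> then 0
            else exp (- rate (Y n \<omega>) * s') * (measure (K (Y n \<omega>)) B / rate (Y n \<omega>))) = emeasure (\<kappa> \<omega>) X"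
        by simp
    qed
    also have "\<dots> = emeasure (M \<bind> \<kappa>) X"
      by (rule emeasure_bind[OF not_empty \<kappa>_measurable XN, symmetric])
    finally show "emeasure \<nu> X = emeasure (M \<bind> \<kappa>) X" .
  qed
  then have "(\<integral>\<^sup>+ z. f z \<partial>\<nu>) = (\<integral>\<^sup>+ \<omega>. \<integral>\<^sup>+ z. f z \<partial>\<kappa> \<omega> \<partial>M)"
    using nn_integral_bind[OF f \<kappa>_measurable] by simp
  also have "\<dots> = (\<integral>\<^sup>+ \<omega>. indicator {\<omega>. J n \<omega> < \<infinity>} \<omega> *
            (\<integral>\<^sup>+ r. indicator {0<..} r * ennreal (exp (- rate (Y n \<omega>) * r)) *
               (\<integral>\<^sup>+ \<xi>. f (Z \<omega>, r, \<xi>) \<partial>K (Y n \<omega>)) \<partial>lborel) \<partial>M)"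
  proof (rule nn_integral_cong)
    fix \<omega> assume \<omega>: "\<omega> \<in> space M"
    have [measurable]: "Z \<omega> \<in> space T" using measurable_space[OF measurable_if_history[OF Z] \<omega>] .
    have "(\<integral>\<^sup>+ z. f z \<partial>\<kappa> \<omega>) = (\<integral>\<^sup>+ r. g \<omega> r * (\<integral>\<^sup>+ \<xi>. f (Z \<omega>, r, \<xi>) \<partial>k (Y n \<omega>)) \<partial>lborel)"
      by (rule \<kappa>_int[OF \<omega> f])
    also have "\<dots> = (\<integral>\<^sup>+ r. indicator {\<omega>. J n \<omega> < \<infinity>} \<omega> * (indicator {0<..} r *
        ennreal (exp (- rate (Y n \<omega>) * r)) * (\<integral>\<^sup>+ \<xi>. f (Z \<omega>, r, \<xi>) \<partial>K (Y n \<omega>))) \<partial>lborel)"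
      by (intro nn_integral_cong) (simp add: g_def R_def K_eq[OF Y_in[OF \<omega>]] mult_ac)
    finally show "(\<integral>\<^sup>+ z. f z \<partial>\<kappa> \<omega>) = indicator {\<omega>. J n \<omega> < \<infinity>} \<omega> *
            (\<integral>\<^sup>+ r. indicator {0<..} r * ennreal (exp (- rate (Y n \<omega>) * r)) *
               (\<integral>\<^sup>+ \<xi>. f (Z \<omega>, r, \<xi>) \<partial>K (Y n \<omega>)) \<partial>lborel)"
      by (cases "J n \<omega> < \<infinity>") auto
  qed
  finally have iterated: "(\<integral>\<^sup>+ z. f z \<partial>\<nu>) = (\<integral>\<^sup>+ \<omega>. indicator {\<omega>. J n \<omega> < \<infinity>} \<omega> *
            (\<integral>\<^sup>+ r. indicator {0<..} r * ennreal (exp (- rate (Y n \<omega>) * r)) *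
               (\<integral>\<^sup>+ \<xi>. f (Z \<omega>, r, \<xi>) \<partial>K (Y n \<omega>)) \<partial>lborel) \<partial>M)" .
  have "(\<integral>\<^sup>+ \<omega>. indicator {\<omega>. J (Suc n) \<omega> < \<infinity>} \<omega> * f (W \<omega>) \<partial>M)
      = (\<integral>\<^sup>+ \<omega>. indicator {\<omega> \<in> space M. J (Suc n) \<omega> < \<infinity>} \<omega> * f (W \<omega>) \<partial>M)"
    by (intro nn_integral_cong) (auto split: split_indicator)
  also have "\<dots> = (\<integral>\<^sup>+ \<omega>. f (W \<omega>) \<partial>density M (indicator {\<omega> \<in> space M. J (Suc n) \<omega> < \<infinity>}))"
    by (rule nn_integral_density[symmetric]) measurable
  also have "\<dots> = (\<integral>\<^sup>+ z. f z \<partial>\<nu>)"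
    unfolding \<nu>_def by (rule nn_integral_distr[symmetric]) measurable
  finally show ?thesis unfolding iterated W_def .
qed

end

section \<open>A Lyapunov function for the deviation from the flow\<close>

text \<open>In both functions \<open>p\<close> is the value at time \<open>0\<close> of the reference trajectory, so that the reference point at
  time \<open>t\<close> is \<open>saddle_flow \<mu> l t p\<close> and \<open>p\<close> itself does not move. For the flow restarted at \<open>t\<^sub>0\<close> one takes
  \<open>p = saddle_flow \<mu> l (- t\<^sub>0) (X t\<^sub>0)\<close>.\<close>
definition scaled_dev :: "real \<Rightarrow> real \<Rightarrow> real \<Rightarrow> real^2 \<Rightarrow> real^2 \<Rightarrow> real" where
  "scaled_dev \<mu> l t y p = exp (- 2 * l * t) * (norm (y - saddle_flow \<mu> l t p))\<^sup>2"

definition lyapunov :: "real \<Rightarrow> real \<Rightarrow> real \<Rightarrow> real \<Rightarrow> real^2 \<Rightarrow> real^2 \<Rightarrow> real" where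
  "lyapunov \<mu> l d t y p = (1 + exp (- l * t)) * scaled_dev \<mu> l t y p + d * exp (- l * t)"

lemma scaled_dev_nonneg: "0 \<le> scaled_dev \<mu> l t y p"
  by (simp add: scaled_dev_def)

lemma scaled_dev_le_lyapunov: "d \<ge> 0 \<Longrightarrow> scaled_dev \<mu> l t y p \<le> lyapunov \<mu> l d t y p"
  using scaled_dev_nonneg[of \<mu> l t y p] by (simp add: lyapunov_def distrib_right)

lemma lyapunov_nonneg: "d \<ge> 0 \<Longrightarrow> 0 \<le> lyapunov \<mu> l d t y p"
  using scaled_dev_le_lyapunov scaled_dev_nonneg order_trans by blast

lemma saddle_flow_inverse: "saddle_flow \<mu> l t (saddle_flow \<mu> l (- t) y) = y"
  by (simp add: saddle_flow_def vec_eq_iff forall_2 flip: exp_add mult.assoc)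

lemma saddle_flow_compose:
  "saddle_flow \<mu> l t (saddle_flow \<mu> l s y) = saddle_flow \<mu> l (t + s) y"
  by (simp add: saddle_flow_def vec_eq_iff forall_2 distrib_left flip: exp_add mult.assoc)

lemma lyapunov_at_reference:
  "lyapunov \<mu> l d t y (saddle_flow \<mu> l (- t) y) = d * exp (- l * t)"
  by (simp add: lyapunov_def scaled_dev_def saddle_flow_inverse)

lemma norm_vec2_power2: "(norm (x :: real^2))\<^sup>2 = (x $ 1)\<^sup>2 + (x $ 2)\<^sup>2"
  by (simp add: norm_vec_def L2_set_def sum_2 sum_nonneg)

lemma scaled_dev_components:
  "scaled_dev \<mu> l t y p = exp (- 2 * l * t) *
     ((y $ 1 - exp (- \<mu> * t) * p $ 1)\<^sup>2 + (y $ 2 - exp (l * t) * p $ 2)\<^sup>2)"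
  by (simp add: scaled_dev_def norm_vec2_power2 saddle_flow_def)

lemma continuous_on_scaled_dev: "continuous_on A (\<lambda>t. scaled_dev \<mu> l t y p)"
  unfolding scaled_dev_components by (intro continuous_intros)

lemma saddle_flow_measurable [measurable]:
  assumes [measurable]: "f \<in> borel_measurable N" "g \<in> borel_measurable N"
  shows "(\<lambda>x. saddle_flow \<mu> l (f x) (g x)) \<in> borel_measurable N"
proof -
  have eq: "saddle_flow \<mu> l t x =
      (exp (- \<mu> * t) * x $ 1) *\<^sub>R axis 1 1 + (exp (l * t) * x $ 2) *\<^sub>R axis 2 1" for t x
    by (simp add: saddle_flow_def vec_eq_iff forall_2 axis_def)
  show ?thesis unfolding eq by (simp add: cart_eq_inner_axis) measurable
qed

lemma scaled_dev_measurable [measurable]: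
  assumes [measurable]: "f \<in> borel_measurable N" "g \<in> borel_measurable N" "h \<in> borel_measurable N"
  shows "(\<lambda>x. scaled_dev \<mu> l (f x) (g x) (h x)) \<in> borel_measurable N"
  unfolding scaled_dev_def by measurable

lemma lyapunov_measurable [measurable]:
  assumes [measurable]: "f \<in> borel_measurable N" "g \<in> borel_measurable N" "h \<in> borel_measurable N"
  shows "(\<lambda>x. lyapunov \<mu> l d (f x) (g x) (h x)) \<in> borel_measurable N"
  unfolding lyapunov_def by measurable

definition lyapunov_deriv :: "real \<Rightarrow> real \<Rightarrow> real \<Rightarrow> real \<Rightarrow> real^2 \<Rightarrow> real^2 \<Rightarrow> real" where
  "lyapunov_deriv \<mu> l d t y p =
     (let f = saddle_flow \<mu> l t p; u = y - f; E = exp (- l * t) in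
        E\<^sup>2 * (- (2 * l + 3 * l * E) * (norm u)\<^sup>2 + 2 * (1 + E) * (\<mu> * u $ 1 * f $ 1 - l * u $ 2 * f $ 2))
        - l * d * E)"

lemma lyapunov_has_derivative:
  "((\<lambda>t. lyapunov \<mu> l d t y p) has_real_derivative lyapunov_deriv \<mu> l d t y p) (at t)"
proof -
  define E where "E = exp (- l * t)"
  define f1 where "f1 = exp (- \<mu> * t) * p $ 1"
  define f2 where "f2 = exp (l * t) * p $ 2"
  have E2: "exp (- 2 * l * t) = E\<^sup>2" by (simp add: E_def flip: exp_double)
  have dE: "((\<lambda>t. exp (- l * t)) has_real_derivative - l * E) (at t)"
    unfolding E_def by (auto intro!: derivative_eq_intros)
  have dE2: "((\<lambda>t. exp (- 2 * l * t)) has_real_derivative - 2 * l * E\<^sup>2) (at t)"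
    unfolding E2[symmetric] by (auto intro!: derivative_eq_intros)
  have df1: "((\<lambda>t. exp (- \<mu> * t) * p $ 1) has_real_derivative - \<mu> * f1) (at t)"
    unfolding f1_def by (auto intro!: derivative_eq_intros)
  have df2: "((\<lambda>t. exp (l * t) * p $ 2) has_real_derivative l * f2) (at t)"
    unfolding f2_def by (auto intro!: derivative_eq_intros)
  have "((\<lambda>t. lyapunov \<mu> l d t y p) has_real_derivative
     (- l * E) * (E\<^sup>2 * ((y $ 1 - f1)\<^sup>2 + (y $ 2 - f2)\<^sup>2))
     + (- 2 * l * E\<^sup>2 * ((y $ 1 - f1)\<^sup>2 + (y $ 2 - f2)\<^sup>2)
         + (2 * (y $ 1 - f1) * (\<mu> * f1) + 2 * (y $ 2 - f2) * (- l * f2)) * E\<^sup>2) * (1 + E)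
     + d * (- l * E)) (at t)"
    unfolding lyapunov_def scaled_dev_components
    by (rule derivative_eq_intros dE dE2 df1 df2 refl)+
      (simp only: E2 E_def[symmetric] f1_def[symmetric] f2_def[symmetric], simp add: algebra_simps)
  moreover have "lyapunov_deriv \<mu> l d t y p = 
     (- l * E) * (E\<^sup>2 * ((y $ 1 - f1)\<^sup>2 + (y $ 2 - f2)\<^sup>2))
     + (- 2 * l * E\<^sup>2 * ((y $ 1 - f1)\<^sup>2 + (y $ 2 - f2)\<^sup>2)
         + (2 * (y $ 1 - f1) * (\<mu> * f1) + 2 * (y $ 2 - f2) * (- l * f2)) * E\<^sup>2) * (1 + E)
     + d * (- l * E)"
    unfolding lyapunov_deriv_def Let_def E_def[symmetric] norm_vec2_power2
    by (simp add: saddle_flow_def f1_def f2_def) algebra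
  ultimately show ?thesis by simp
qed

lemma lyapunov_deriv_measurable [measurable]:
  assumes [measurable]: "f \<in> borel_measurable N"
  shows "(\<lambda>x. lyapunov_deriv \<mu> l d (f x) y p) \<in> borel_measurable N"
proof -
  have "continuous_on UNIV (\<lambda>t. lyapunov_deriv \<mu> l d t y p)"
    unfolding lyapunov_deriv_def Let_def norm_vec2_power2 saddle_flow_def
    by (simp, intro continuous_intros)
  then have "(\<lambda>t. lyapunov_deriv \<mu> l d t y p) \<in> borel_measurable borel"
    by (rule borel_measurable_continuous_onI)
  from measurable_compose[OF assms this] show ?thesis .
qed

text \<open>The rate of change of \<open>lyapunov\<close> due to the jumps of a kernel with mean \<open>b\<close> and second moment \<open>m\<close>:
  expanding the square, \<open>|u + \<xi>|^2 - |u|^2 = 2 u \<bullet> \<xi> + |\<xi>|^2\<close>.\<close>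
definition jump_increment :: "real \<Rightarrow> real \<Rightarrow> real \<Rightarrow> real^2 \<Rightarrow> real^2 \<Rightarrow> real^2 \<Rightarrow> real \<Rightarrow> real" where
  "jump_increment \<mu> l t y p b m =
     (1 + exp (- l * t)) * exp (- 2 * l * t) * (2 * ((y - saddle_flow \<mu> l t p) \<bullet> b) + m)"

lemma
  fixes \<kappa> :: "(real^2) measure"
  assumes sets: "sets \<kappa> = sets borel" and fin: "finite_measure \<kappa>"
    and id: "integrable \<kappa> (\<lambda>\<xi>. \<xi>)" and sq: "integrable \<kappa> (\<lambda>\<xi>. (norm \<xi>)\<^sup>2)"
  shows integrable_lyapunov_jump: "integrable \<kappa> (\<lambda>\<xi>. lyapunov \<mu> l d t (y + \<xi>) p)"
    and integral_lyapunov_jump: "(\<integral>\<xi>. lyapunov \<mu> l d t (y + \<xi>) p \<partial>\<kappa>) =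
      measure \<kappa> UNIV * lyapunov \<mu> l d t y p
      + jump_increment \<mu> l t y p (\<integral>\<xi>. \<xi> \<partial>\<kappa>) (\<integral>\<xi>. (norm \<xi>)\<^sup>2 \<partial>\<kappa>)"
proof -
  interpret finite_measure \<kappa> by fact
  define u where "u = y - saddle_flow \<mu> l t p"
  define a where "a = (1 + exp (- l * t)) * exp (- 2 * l * t)"
  have sp: "space \<kappa> = UNIV" using sets_eq_imp_space_eq[OF sets] by simp
  have eq: "lyapunov \<mu> l d t (y + \<xi>) p = lyapunov \<mu> l d t y p + a * (2 * (u \<bullet> \<xi>) + (norm \<xi>)\<^sup>2)" for \<xi>
  proof -
    have "y + \<xi> - saddle_flow \<mu> l t p = u + \<xi>" by (simp add: u_def)
    moreover have "(norm (u + \<xi>))\<^sup>2 = (norm u)\<^sup>2 + 2 * (u \<bullet> \<xi>) + (norm \<xi>)\<^sup>2"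
      by (simp add: power2_norm_eq_inner inner_add_left inner_add_right inner_commute)
    ultimately show ?thesis
      unfolding lyapunov_def scaled_dev_def a_def u_def[symmetric] by (simp add: algebra_simps)
  qed
  show "integrable \<kappa> (\<lambda>\<xi>. lyapunov \<mu> l d t (y + \<xi>) p)"
    unfolding eq using id sq by (auto intro!: integrable_inner_right)
  show "(\<integral>\<xi>. lyapunov \<mu> l d t (y + \<xi>) p \<partial>\<kappa>) = measure \<kappa> UNIV * lyapunov \<mu> l d t y p
      + jump_increment \<mu> l t y p (\<integral>\<xi>. \<xi> \<partial>\<kappa>) (\<integral>\<xi>. (norm \<xi>)\<^sup>2 \<partial>\<kappa>)"
    unfolding eq using id sq
    by (simp add: jump_increment_def integrable_inner_right sp a_def u_def)
qed

text \<open>The supermartingale property in infinitesimal form. Let \<open>E = exp (- l t)\<close> and \<open>s = |u|\<close>. The linear part of the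
  drift contributes at most \<open>2 l s^2\<close>, which the derivative of the weight \<open>E^2\<close> cancels; the
  additional weight \<open>1 + E\<close> leaves \<open>- l E s^2\<close>. This absorbs the cross term \<open>4 s \<delta>\<close> at the cost of
  \<open>4 \<delta>^2 / (l E)\<close>, and the derivative \<open>- l d E\<close> of the last summand pays for this cost and the second moment.\<close>
lemma lyapunov_generator_nonpos:
  fixes b y p :: "real^2"
  assumes t: "t \<ge> 0" and l: "l > 0" and \<mu>: "\<mu> > 0"
    and b: "norm (b - saddle_matrix \<mu> l *v y) \<le> \<delta>" and m: "m \<le> v" and v: "v \<ge> 0"
    and d: "4 * \<delta>\<^sup>2 / l + 2 * v \<le> l * d"
  shows "lyapunov_deriv \<mu> l d t y p + jump_increment \<mu> l t y p b m \<le> 0"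
proof -
  define f where "f = saddle_flow \<mu> l t p"
  define u where "u = y - f"
  define E where "E = exp (- l * t)"
  define s where "s = norm u"
  have E: "0 < E" "E \<le> 1" using t l by (auto simp: E_def)
  have E2: "exp (- 2 * l * t) = E\<^sup>2" by (simp add: E_def flip: exp_double)
  have s2: "s\<^sup>2 = (u $ 1)\<^sup>2 + (u $ 2)\<^sup>2" by (simp add: s_def norm_vec2_power2)
  have "u \<bullet> (b - saddle_matrix \<mu> l *v y) \<le> s * \<delta>"
    using norm_cauchy_schwarz[of u "b - saddle_matrix \<mu> l *v y"] mult_left_mono[OF b, of s]
    by (simp add: s_def)
  moreover have "u \<bullet> (saddle_matrix \<mu> l *v y) = - \<mu> * u $ 1 * y $ 1 + l * u $ 2 * y $ 2"
    by (simp add: inner_vec_def sum_2 saddle_matrix_def matrix_vector_mult_def)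
  ultimately have ub: "u \<bullet> b \<le> - \<mu> * u $ 1 * y $ 1 + l * u $ 2 * y $ 2 + s * \<delta>"
    by (simp add: inner_diff_right)
  have y: "y $ i = u $ i + f $ i" for i by (simp add: u_def)
  have "\<mu> * u $ 1 * f $ 1 - l * u $ 2 * f $ 2 + u \<bullet> b \<le> l * s\<^sup>2 + s * \<delta>"
  proof -
    have "0 \<le> (\<mu> + l) * (u $ 1)\<^sup>2" using \<mu> l by simp
    then show ?thesis using ub unfolding y s2 by (simp add: algebra_simps power2_eq_square)
  qed
  then have "2 * (\<mu> * u $ 1 * f $ 1 - l * u $ 2 * f $ 2) + (2 * (u \<bullet> b) + m) \<le> 2 * l * s\<^sup>2 + 2 * s * \<delta> + v"
    using m by simp
  then have "(1 + E) * (2 * (\<mu> * u $ 1 * f $ 1 - l * u $ 2 * f $ 2) + (2 * (u \<bullet> b) + m))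
      \<le> (1 + E) * (2 * l * s\<^sup>2 + 2 * s * \<delta> + v)"
    using E by (intro mult_left_mono) auto
  also have "\<dots> \<le> (2 * l + 2 * l * E) * s\<^sup>2 + 4 * s * \<delta> + 2 * v"
  proof -
    have "\<delta> \<ge> 0" using b norm_ge_zero order_trans by blast
    then have "0 \<le> (1 - E) * (2 * s * \<delta> + v)" using E v by (intro mult_nonneg_nonneg) (auto simp: s_def)
    then show ?thesis by (simp add: algebra_simps)
  qed
  finally have 1: "- (2 * l + 3 * l * E) * s\<^sup>2
      + (1 + E) * (2 * (\<mu> * u $ 1 * f $ 1 - l * u $ 2 * f $ 2) + (2 * (u \<bullet> b) + m))
      \<le> - l * E * s\<^sup>2 + 4 * s * \<delta> + 2 * v"
    by (simp add: algebra_simps)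
  \<comment> \<open>Completing the square in \<open>s\<close>.\<close>
  have "0 \<le> (l * E * s - 2 * \<delta>)\<^sup>2" by simp
  then have "l * E * (- l * E * s\<^sup>2 + 4 * s * \<delta>) \<le> 4 * \<delta>\<^sup>2"
    by (simp add: power2_eq_square algebra_simps)
  then have "E * (- l * E * s\<^sup>2 + 4 * s * \<delta>) \<le> 4 * \<delta>\<^sup>2 / l"
    using l by (simp add: pos_le_divide_eq mult_ac)
  moreover have "E * (2 * v) \<le> 2 * v" using E v by (simp add: mult_left_le_one_le)
  ultimately have "E * (- l * E * s\<^sup>2 + 4 * s * \<delta> + 2 * v) \<le> l * d"
    using d by (simp add: distrib_left)
  then have 2: "E * (E * (- l * E * s\<^sup>2 + 4 * s * \<delta> + 2 * v)) \<le> E * (l * d)"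
    using E by (intro mult_left_mono) auto
  have "lyapunov_deriv \<mu> l d t y p + jump_increment \<mu> l t y p b m
      = E\<^sup>2 * (- (2 * l + 3 * l * E) * s\<^sup>2
      + (1 + E) * (2 * (\<mu> * u $ 1 * f $ 1 - l * u $ 2 * f $ 2) + (2 * (u \<bullet> b) + m))) - l * d * E"
    unfolding lyapunov_deriv_def jump_increment_def Let_def f_def[symmetric] u_def[symmetric]
      E_def[symmetric] E2 s_def[symmetric] by (simp add: algebra_simps)
  also have "\<dots> \<le> E\<^sup>2 * (- l * E * s\<^sup>2 + 4 * s * \<delta> + 2 * v) - l * d * E"
    using 1 by (intro diff_right_mono mult_left_mono) auto
  also have "\<dots> \<le> 0" using 2 by (simp add: power2_eq_square mult_ac)
  finally show ?thesis .
qed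

section \<open>One holding interval\<close>

text \<open>A comparison form of the fundamental theorem of calculus. The end value is kept on the left, so that inequalities
  on adjacent intervals can be chained.\<close>
lemma nn_integral_le_decrease:
  fixes F F' :: "real \<Rightarrow> real"
  assumes F: "\<And>r. r \<in> {a..b} \<Longrightarrow> (F has_real_derivative F' r) (at r)"
    and [measurable]: "F' \<in> borel_measurable borel"
    and F': "\<And>r. r \<in> {a..b} \<Longrightarrow> F' r \<le> 0"
    and g: "\<And>r. r \<in> {a<..b} \<Longrightarrow> g r \<le> ennreal (- F' r)"
    and ab: "a \<le> b" and Fb: "0 \<le> F b"
  shows "(\<integral>\<^sup>+ r. indicator {a<..b} r * g r \<partial>lborel) + ennreal (F b) \<le> ennreal (F a)"
proof -
  have dec: "F b \<le> F a"
    by (rule DERIV_nonpos_imp_nonincreasing[OF ab]) (use F F' in \<open>auto intro!: exI\<close>)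
  have "(\<integral>\<^sup>+ r. indicator {a<..b} r * g r \<partial>lborel) \<le> (\<integral>\<^sup>+ r. ennreal (- F' r) * indicator {a..b} r \<partial>lborel)"
    using g by (intro nn_integral_mono) (auto split: split_indicator)
  also have "\<dots> = ennreal (- F b - (- F a))"
    using F' ab by (intro nn_integral_FTC_Icc) (auto intro!: derivative_eq_intros F)
  finally have "(\<integral>\<^sup>+ r. indicator {a<..b} r * g r \<partial>lborel) + ennreal (F b) \<le> ennreal (F a - F b) + ennreal (F b)"
    by (intro add_right_mono) simp
  also have "\<dots> = ennreal (F a)"
    using dec Fb by (subst ennreal_plus[symmetric]) auto
  finally show ?thesis .
qed

text \<open>Restricting to rational times keeps this event measurable; \<open>exceedsI\<close> recovers arbitrary times, since the
  deviation is continuous between jumps.\<close>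
definition exceeds :: "real \<Rightarrow> real \<Rightarrow> real \<Rightarrow> real \<Rightarrow> ereal \<Rightarrow> real^2 \<Rightarrow> real^2 \<Rightarrow> bool" where
  "exceeds \<mu> l c a T y p \<longleftrightarrow> (\<exists>t\<in>\<rat>. a < t \<and> ereal t < T \<and> c < scaled_dev \<mu> l t y p)"

lemma exceedsI:
  assumes "a \<le> t" "ereal t < T" "c < scaled_dev \<mu> l t y p"
  shows "exceeds \<mu> l c a T y p"
proof -
  have op: "open {s. c < scaled_dev \<mu> l s y p}"
    by (intro open_Collect_less continuous_on_scaled_dev continuous_on_const)
  then obtain e where e: "e > 0" "ball t e \<subseteq> {s. c < scaled_dev \<mu> l s y p}"
    using assms(3) openE by blast
  obtain u where u: "t < u" "ereal u < T"
    using ereal_dense2[OF assms(2)] by auto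
  define v where "v = min u (t + e)"
  obtain q where q: "q \<in> \<rat>" "t < q" "q < v"
    using Rats_dense_in_real[of t v] u e by (auto simp: v_def)
  have "q \<in> ball t e" using q by (auto simp: v_def dist_real_def)
  moreover have "ereal q < T"
    by (rule less_trans[OF _ u(2)]) (use q in \<open>simp add: v_def\<close>)
  ultimately show ?thesis
    unfolding exceeds_def using q e assms(1) by (auto intro!: bexI[of _ q])
qed

text \<open>The data of one holding interval: the current state \<open>y\<close>, the jump kernel \<open>\<kappa>\<close> there, and the reference
  \<open>p\<close>. The deviation is measured from time \<open>t\<^sub>0\<close> on, and \<open>c\<close> is the level not to be crossed.\<close>
locale saddle_jump_kernel =
  fixes \<mu> l d c t\<^sub>0 \<delta> v :: real and \<kappa> :: "(real^2) measure" and y p :: "real^2"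
  assumes l: "l > 0" and \<mu>: "\<mu> > 0" and d: "d \<ge> 0" and c: "c > 0" and t\<^sub>0: "t\<^sub>0 \<ge> 0" and v: "v \<ge> 0"
    and budget: "4 * \<delta>\<^sup>2 / l + 2 * v \<le> l * d"
    and sets: "sets \<kappa> = sets borel" and fin: "finite_measure \<kappa>"
    and id: "integrable \<kappa> (\<lambda>\<xi>. \<xi>)" and sq: "integrable \<kappa> (\<lambda>\<xi>. (norm \<xi>)\<^sup>2)"
    and mean: "norm ((\<integral>\<xi>. \<xi> \<partial>\<kappa>) - saddle_matrix \<mu> l *v y) \<le> \<delta>"
    and second_moment: "(\<integral>\<xi>. (norm \<xi>)\<^sup>2 \<partial>\<kappa>) \<le> v"
begin

abbreviation q :: real where "q \<equiv> measure \<kappa> UNIV"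

text \<open>The expected Lyapunov value, multiplied by the total jump rate, after a jump at time \<open>T\<close>. Up to time \<open>t\<^sub>0\<close> the
  reference follows the process, so a jump resets it; there is no deviation yet and the Lyapunov function
  is frozen at its value at \<open>t\<^sub>0\<close>.\<close>
definition after_jump :: "real \<Rightarrow> ennreal" where
  "after_jump T = (\<integral>\<^sup>+ \<xi>. ennreal (lyapunov \<mu> l d (max T t\<^sub>0) (y + \<xi>)
      (if T \<le> t\<^sub>0 then saddle_flow \<mu> l (- t\<^sub>0) (y + \<xi>) else p)) \<partial>\<kappa>)"

lemma space_kappa: "space \<kappa> = UNIV"
  using sets_eq_imp_space_eq[OF sets] by simp

lemma after_jump_measurable [measurable]: "after_jump \<in> borel_measurable borel"
proof -
  interpret finite_measure \<kappa> by (rule fin)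
  note [measurable_cong] = sets
  show ?thesis unfolding after_jump_def[abs_def] by measurable
qed

lemma after_jump_early:
  assumes "T \<le> t\<^sub>0"
  shows "after_jump T = ennreal (q * (d * exp (- l * t\<^sub>0)))"
proof -
  interpret finite_measure \<kappa> by (rule fin)
  have "max T t\<^sub>0 = t\<^sub>0" using assms by simp
  then have "after_jump T = (\<integral>\<^sup>+ \<xi>. ennreal (d * exp (- l * t\<^sub>0)) \<partial>\<kappa>)"
    unfolding after_jump_def using assms by (simp add: lyapunov_at_reference del: minus_mult_left)
  then show ?thesis
    using d by (simp add: space_kappa emeasure_eq_measure ennreal_mult mult.commute)
qed

lemma after_jump_late:
  assumes "t\<^sub>0 < T"
  shows "after_jump T \<le> ennreal (q * lyapunov \<mu> l d T y p - lyapunov_deriv \<mu> l d T y p)"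
proof -
  have "max T t\<^sub>0 = T" using assms by simp
  then have "after_jump T = (\<integral>\<^sup>+ \<xi>. ennreal (lyapunov \<mu> l d T (y + \<xi>) p) \<partial>\<kappa>)"
    unfolding after_jump_def using assms by simp
  also have "\<dots> = ennreal (\<integral>\<xi>. lyapunov \<mu> l d T (y + \<xi>) p \<partial>\<kappa>)"
    using lyapunov_nonneg[OF d]
    by (intro nn_integral_eq_integral integrable_lyapunov_jump[OF sets fin id sq]) auto
  also have "\<dots> \<le> ennreal (q * lyapunov \<mu> l d T y p - lyapunov_deriv \<mu> l d T y p)"
    unfolding integral_lyapunov_jump[OF sets fin id sq]
    using lyapunov_generator_nonpos[of T l \<mu> "\<integral>\<xi>. \<xi> \<partial>\<kappa>" y \<delta> _ v d p, OF _ l \<mu> mean second_moment v budget]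
      assms t\<^sub>0 by (intro ennreal_leI) simp
  finally show ?thesis .
qed

lemma rate_lyapunov_minus_deriv_nonneg:
  assumes "t\<^sub>0 \<le> T"
  shows "0 \<le> q * lyapunov \<mu> l d T y p - lyapunov_deriv \<mu> l d T y p"
proof -
  have "0 \<le> (\<integral>\<xi>. lyapunov \<mu> l d T (y + \<xi>) p \<partial>\<kappa>)"
    by (intro Bochner_Integration.integral_nonneg lyapunov_nonneg d)
  also have "\<dots> \<le> q * lyapunov \<mu> l d T y p - lyapunov_deriv \<mu> l d T y p"
    unfolding integral_lyapunov_jump[OF sets fin id sq]
    using lyapunov_generator_nonpos[of T l \<mu> "\<integral>\<xi>. \<xi> \<partial>\<kappa>" y \<delta> _ v d p, OF _ l \<mu> mean second_moment v budget]
      assms t\<^sub>0 by simp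
  finally show ?thesis .
qed

text \<open>Along a holding interval the function \<open>exp (- q r) lyapunov (t + r)\<close> loses at least what the jumps
  collect: its derivative is \<open>exp (- q r) (lyapunov_deriv - q lyapunov)\<close>, and \<open>q lyapunov - lyapunov_deriv\<close>
  dominates \<open>after_jump\<close> by the generator inequality.\<close>
lemma holding_late:
  assumes "0 \<le> a" "a \<le> b" "t\<^sub>0 \<le> t + a"
  shows "(\<integral>\<^sup>+ r. indicator {a<..b} r * (ennreal (exp (- q * r)) * after_jump (t + r)) \<partial>lborel)
      + ennreal (exp (- q * b) * lyapunov \<mu> l d (t + b) y p)
    \<le> ennreal (exp (- q * a) * lyapunov \<mu> l d (t + a) y p)"
proof (rule nn_integral_le_decrease[where F = "\<lambda>r. exp (- q * r) * lyapunov \<mu> l d (t + r) y p"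
      and F' = "\<lambda>r. - (exp (- q * r) * (q * lyapunov \<mu> l d (t + r) y p - lyapunov_deriv \<mu> l d (t + r) y p))"])
  fix r
  have D: "((\<lambda>r. lyapunov \<mu> l d (t + r) y p) has_real_derivative lyapunov_deriv \<mu> l d (t + r) y p * (0 + 1)) (at r)"
    by (rule DERIV_chain'[OF _ lyapunov_has_derivative]) (auto intro!: derivative_eq_intros)
  have E: "((\<lambda>r. exp (- q * r)) has_real_derivative - q * exp (- q * r)) (at r)"
    by (auto intro!: derivative_eq_intros)
  from D have D: "((\<lambda>r. lyapunov \<mu> l d (t + r) y p) has_real_derivative lyapunov_deriv \<mu> l d (t + r) y p) (at r)"
    by simp
  show "((\<lambda>r. exp (- q * r) * lyapunov \<mu> l d (t + r) y p) has_real_derivative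
      - (exp (- q * r) * (q * lyapunov \<mu> l d (t + r) y p - lyapunov_deriv \<mu> l d (t + r) y p))) (at r)"
    by (rule DERIV_cong[OF DERIV_mult[OF E D]]) (simp add: algebra_simps)
  show "- (exp (- q * r) * (q * lyapunov \<mu> l d (t + r) y p - lyapunov_deriv \<mu> l d (t + r) y p)) \<le> 0"
    if "r \<in> {a..b}"
    using rate_lyapunov_minus_deriv_nonneg[of "t + r"] that assms by simp
  show "ennreal (exp (- q * r)) * after_jump (t + r) \<le> ennreal (- (- (exp (- q * r) *
      (q * lyapunov \<mu> l d (t + r) y p - lyapunov_deriv \<mu> l d (t + r) y p))))"
    if "r \<in> {a<..b}"
    using after_jump_late[of "t + r"] rate_lyapunov_minus_deriv_nonneg[of "t + r"] that assms
    by (simp add: ennreal_mult mult_left_mono)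
next
  show "(\<lambda>r. - (exp (- q * r) * (q * lyapunov \<mu> l d (t + r) y p - lyapunov_deriv \<mu> l d (t + r) y p)))
      \<in> borel_measurable borel"
    by measurable
qed (use assms lyapunov_nonneg[OF d] in auto)

lemma holding_early:
  assumes "a \<le> b" "t + b \<le> t\<^sub>0"
  shows "(\<integral>\<^sup>+ r. indicator {a<..b} r * (ennreal (exp (- q * r)) * after_jump (t + r)) \<partial>lborel)
      + ennreal (exp (- q * b) * (d * exp (- l * t\<^sub>0)))
    \<le> ennreal (exp (- q * a) * (d * exp (- l * t\<^sub>0)))"
proof (rule nn_integral_le_decrease[where F = "\<lambda>r. exp (- q * r) * (d * exp (- l * t\<^sub>0))"
      and F' = "\<lambda>r. - (exp (- q * r) * (q * (d * exp (- l * t\<^sub>0))))"])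
  fix r
  show "((\<lambda>r. exp (- q * r) * (d * exp (- l * t\<^sub>0))) has_real_derivative
      - (exp (- q * r) * (q * (d * exp (- l * t\<^sub>0))))) (at r)"
    by (auto intro!: derivative_eq_intros)
  show "ennreal (exp (- q * r)) * after_jump (t + r) \<le> ennreal (- (- (exp (- q * r) * (q * (d * exp (- l * t\<^sub>0))))))"
    if "r \<in> {a<..b}"
    using that assms d by (simp add: after_jump_early ennreal_mult)
qed (use assms d in auto)

lemma holding:
  assumes R: "0 \<le> R" and p: "t \<le> t\<^sub>0 \<Longrightarrow> p = saddle_flow \<mu> l (- t\<^sub>0) y"
  shows "(\<integral>\<^sup>+ r. indicator {0<..R} r * (ennreal (exp (- q * r)) * after_jump (t + r)) \<partial>lborel)
      + ennreal (exp (- q * R) * lyapunov \<mu> l d (max (t + R) t\<^sub>0) y p)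
    \<le> ennreal (lyapunov \<mu> l d (max t t\<^sub>0) y p)"
proof -
  consider "t\<^sub>0 \<le> t" | "t < t\<^sub>0" "t + R \<le> t\<^sub>0" | "t < t\<^sub>0" "t\<^sub>0 < t + R" by linarith
  then show ?thesis
  proof cases
    case 1
    then show ?thesis using holding_late[of 0 R t] R by (simp add: max_absorb1)
  next
    case 2
    then have "lyapunov \<mu> l d t\<^sub>0 y p = d * exp (- l * t\<^sub>0)"
      using p by (simp add: lyapunov_at_reference del: minus_mult_left)
    then show ?thesis using holding_early[of 0 R t] R 2 by (simp add: max_absorb2)
  next
    case 3
    define b where "b = t\<^sub>0 - t"
    have b: "0 \<le> b" "b \<le> R" "t + b = t\<^sub>0" using 3 by (auto simp: b_def)
    define g where "g r = ennreal (exp (- q * r)) * after_jump (t + r)" for r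
    have ref: "lyapunov \<mu> l d t\<^sub>0 y p = d * exp (- l * t\<^sub>0)"
      using 3 p by (simp add: lyapunov_at_reference del: minus_mult_left)
    have [measurable]: "g \<in> borel_measurable borel" unfolding g_def by measurable
    have "(\<integral>\<^sup>+ r. indicator {0<..R} r * g r \<partial>lborel)
        = (\<integral>\<^sup>+ r. indicator {0<..b} r * g r + indicator {b<..R} r * g r \<partial>lborel)"
      using b by (intro nn_integral_cong) (auto split: split_indicator)
    also have "\<dots> = (\<integral>\<^sup>+ r. indicator {0<..b} r * g r \<partial>lborel) + (\<integral>\<^sup>+ r. indicator {b<..R} r * g r \<partial>lborel)"
      by (intro nn_integral_add) auto
    finally have "(\<integral>\<^sup>+ r. indicator {0<..R} r * g r \<partial>lborel)
          + ennreal (exp (- q * R) * lyapunov \<mu> l d (t + R) y p)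
        = (\<integral>\<^sup>+ r. indicator {0<..b} r * g r \<partial>lborel) + ((\<integral>\<^sup>+ r. indicator {b<..R} r * g r \<partial>lborel)
          + ennreal (exp (- q * R) * lyapunov \<mu> l d (t + R) y p))"
      by (simp add: add.assoc)
    also have "\<dots> \<le> (\<integral>\<^sup>+ r. indicator {0<..b} r * g r \<partial>lborel) + ennreal (exp (- q * b) * lyapunov \<mu> l d t\<^sub>0 y p)"
      using holding_late[of b R t] b by (intro add_left_mono) (simp add: g_def)
    also have "\<dots> \<le> ennreal (lyapunov \<mu> l d t\<^sub>0 y p)"
      using holding_early[of 0 b t] b unfolding ref by (simp add: g_def)
    finally show ?thesis
      using 3 by (simp add: g_def max_absorb1 max_absorb2)
  qed
qed

text \<open>The one-step inequality. If the level is crossed during the holding interval, the expectation is stopped at the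
  crossing time and replaced by \<open>c\<close>, which the Lyapunov function dominates there. The last summand
  on the left is the crossing in an absorbing state, where the holding interval has no end.\<close>
lemma holding_interval:
  assumes p: "t \<le> t\<^sub>0 \<Longrightarrow> p = saddle_flow \<mu> l (- t\<^sub>0) y"
  shows "(\<integral>\<^sup>+ r. indicator {0<..} r * (ennreal (exp (- q * r)) *
        (if exceeds \<mu> l c (max t t\<^sub>0) (ereal (t + r)) y p then ennreal (c * q) else after_jump (t + r))) \<partial>lborel)
      + (if q = 0 \<and> exceeds \<mu> l c (max t t\<^sub>0) \<infinity> y p then ennreal c else 0)
    \<le> ennreal (lyapunov \<mu> l d (max t t\<^sub>0) y p)"
proof (cases "exceeds \<mu> l c (max t t\<^sub>0) \<infinity> y p")
  case False
  then have never: "\<not> exceeds \<mu> l c (max t t\<^sub>0) T y p" for T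
    by (auto simp: exceeds_def)
  define g where "g r = ennreal (exp (- q * r)) * after_jump (t + r)" for r
  have [measurable]: "g \<in> borel_measurable borel" unfolding g_def by measurable
  have sup: "indicator {0<..} r * g r = (SUP n. indicator {0<..real n} r * g r)" for r :: real
  proof (rule antisym)
    obtain n :: nat where "r \<le> real n" using real_arch_simple by blast
    then show "indicator {0<..} r * g r \<le> (SUP n. indicator {0<..real n} r * g r)"
      by (intro SUP_upper2[of n]) (auto split: split_indicator)
    show "(SUP n. indicator {0<..real n} r * g r) \<le> indicator {0<..} r * g r"
      by (intro SUP_least) (auto split: split_indicator)
  qed
  have "(\<integral>\<^sup>+ r. indicator {0<..} r * g r \<partial>lborel) = (SUP n. \<integral>\<^sup>+ r. indicator {0<..real n} r * g r \<partial>lborel)"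
    unfolding sup
    by (intro nn_integral_monotone_convergence_SUP)
      (auto simp: incseq_def le_fun_def split: split_indicator)
  also have "\<dots> \<le> ennreal (lyapunov \<mu> l d (max t t\<^sub>0) y p)"
  proof (rule SUP_least)
    fix n :: nat
    show "(\<integral>\<^sup>+ r. indicator {0<..real n} r * g r \<partial>lborel) \<le> ennreal (lyapunov \<mu> l d (max t t\<^sub>0) y p)"
      unfolding g_def by (rule order_trans[OF _ holding[OF _ p, of "real n"]]) auto
  qed
  finally show ?thesis using False by (simp add: never g_def)
next
  case True
  define A where "A = {s. max t t\<^sub>0 \<le> s \<and> c < scaled_dev \<mu> l s y p}"
  define \<tau> where "\<tau> = Inf A"
  define R where "R = \<tau> - t"
  have ne: "A \<noteq> {}" using True by (auto simp: exceeds_def A_def intro: less_imp_le)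
  have bdd: "bdd_below A" by (rule bdd_belowI[of _ "max t t\<^sub>0"]) (simp add: A_def)
  have \<tau>_ge: "max t t\<^sub>0 \<le> \<tau>" unfolding \<tau>_def by (rule cInf_greatest[OF ne]) (simp add: A_def)
  have "closed {s. c \<le> scaled_dev \<mu> l s y p}"
    by (intro closed_Collect_le continuous_on_scaled_dev continuous_on_const)
  then have "closure A \<subseteq> {s. c \<le> scaled_dev \<mu> l s y p}"
    by (intro closure_minimal) (auto simp: A_def)
  then have dev_\<tau>: "c \<le> scaled_dev \<mu> l \<tau> y p"
    using closure_contains_Inf[OF ne bdd] by (auto simp: \<tau>_def)
  have exceeds_iff: "exceeds \<mu> l c (max t t\<^sub>0) (ereal T) y p \<longleftrightarrow> \<tau> < T" for T
  proof
    assume "exceeds \<mu> l c (max t t\<^sub>0) (ereal T) y p"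
    then obtain s where "s \<in> A" "s < T" by (auto simp: exceeds_def A_def intro: less_imp_le)
    then show "\<tau> < T" unfolding \<tau>_def using cInf_lower[OF _ bdd] by force
  next
    assume "\<tau> < T"
    then obtain s where "s \<in> A" "s < T" unfolding \<tau>_def using cInf_lessD[OF ne] by blast
    then show "exceeds \<mu> l c (max t t\<^sub>0) (ereal T) y p"
      by (intro exceedsI[of _ s]) (auto simp: A_def)
  qed
  have R: "0 \<le> R" "max (t + R) t\<^sub>0 = \<tau>" using \<tau>_ge by (auto simp: R_def)
  define g where "g r = ennreal (exp (- q * r)) * after_jump (t + r)" for r
  have [measurable]: "g \<in> borel_measurable borel" unfolding g_def by measurable
  have "(\<integral>\<^sup>+ r. indicator {0<..} r * (ennreal (exp (- q * r)) *
        (if exceeds \<mu> l c (max t t\<^sub>0) (ereal (t + r)) y p then ennreal (c * q) else after_jump (t + r))) \<partial>lborel)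
      = (\<integral>\<^sup>+ r. indicator {0<..R} r * g r + ennreal (c * q) * (indicator {R<..} r * ennreal (exp (- q * r))) \<partial>lborel)"
    using R(1) by (intro nn_integral_cong)
      (auto simp: exceeds_iff g_def R_def mult.commute split: split_indicator)
  also have "\<dots> = (\<integral>\<^sup>+ r. indicator {0<..R} r * g r \<partial>lborel)
      + ennreal (c * q) * (\<integral>\<^sup>+ r. indicator {R<..} r * ennreal (exp (- q * r)) \<partial>lborel)"
    by (subst nn_integral_add) (auto simp: nn_integral_cmult)
  also have "\<dots> + (if q = 0 \<and> exceeds \<mu> l c (max t t\<^sub>0) \<infinity> y p then ennreal c else 0)
      = (\<integral>\<^sup>+ r. indicator {0<..R} r * g r \<partial>lborel) + ennreal (exp (- q * R) * c)"
  proof (cases "q = 0")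
    case False
    then have "q > 0" by (simp add: less_le)
    then have "ennreal (c * q) * (\<integral>\<^sup>+ r. indicator {R<..} r * ennreal (exp (- q * r)) \<partial>lborel)
        = ennreal (exp (- q * R) * c)"
      using c by (subst nn_integral_exp_tail) (simp_all add: ennreal_mult[symmetric] mult.commute)
    then show ?thesis using False by simp
  qed (use True in simp)
  also have "\<dots> \<le> (\<integral>\<^sup>+ r. indicator {0<..R} r * g r \<partial>lborel)
      + ennreal (exp (- q * R) * lyapunov \<mu> l d (max (t + R) t\<^sub>0) y p)"
    unfolding R(2) using dev_\<tau> scaled_dev_le_lyapunov[OF d, of \<mu> l \<tau> y p]
    by (intro add_left_mono ennreal_leI mult_left_mono) auto
  also have "\<dots> \<le> ennreal (lyapunov \<mu> l d (max t t\<^sub>0) y p)"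
    unfolding g_def by (rule holding[OF R(1) p])
  finally show ?thesis .
qed

end

section \<open>A maximal inequality along the jump chain\<close>

lemma exceeds_measurable [measurable (raw)]:
  assumes [measurable]: "a \<in> borel_measurable N" "T \<in> borel_measurable N"
    "y \<in> borel_measurable N" "p \<in> borel_measurable N"
  shows "Measurable.pred N (\<lambda>x. exceeds \<mu> l c (a x) (T x) (y x) (p x))"
proof -
  have "exceeds \<mu> l c (a x) (T x) (y x) (p x) \<longleftrightarrow>
      (\<exists>r :: rat. a x < of_rat r \<and> ereal (of_rat r) < T x \<and> c < scaled_dev \<mu> l (of_rat r) (y x) (p x))" for x
    by (auto simp: exceeds_def Rats_def)
  then show ?thesis by simp
qed

text \<open>With threshold \<open>0\<close> and no restriction on the jump, the prescribed conditional probability of a further jump is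
  \<open>q / q\<close>.\<close>
lemma (in jump_chain) jump_if_rate_pos:
  "AE \<omega> in M. J n \<omega> < \<infinity> \<longrightarrow> 0 < rate (Y n \<omega>) \<longrightarrow> J (Suc n) \<omega> < \<infinity>"
proof -
  define Z where "Z \<omega> \<longleftrightarrow> J n \<omega> < \<infinity> \<and> 0 < rate (Y n \<omega>)" for \<omega>
  note [measurable] = J_Y_measurable_history(1)[of n n]
  have "Y n \<in> measurable (history n) (restrict_space borel D)"
    using J_Y_measurable_history(2)[of n n] Y_in by (intro measurable_restrict_space2) auto
  moreover have "(\<lambda>x. emeasure (K x) UNIV) \<in> borel_measurable (restrict_space borel D)"
    using kernel by (auto simp: finite_kernel_on_def)
  ultimately have "(\<lambda>\<omega>. emeasure (K (Y n \<omega>)) UNIV) \<in> borel_measurable (history n)"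
    by (rule measurable_compose)
  from measurable_compose[OF this, of enn2real borel]
  have [measurable]: "(\<lambda>\<omega>. rate (Y n \<omega>)) \<in> borel_measurable (history n)"
    by (simp add: measure_def)
  have Z: "Z \<in> measurable (history n) (count_space UNIV)"
    unfolding Z_def[abs_def] by measurable
  have [measurable]: "Measurable.pred M Z" by (rule measurable_if_history[OF Z])
  have "emeasure M {\<omega> \<in> space M. Z \<omega> \<in> {True} \<and> J n \<omega> + ereal 0 < J (Suc n) \<omega> \<and> J (Suc n) \<omega> < \<infinity> \<and>
           Y (Suc n) \<omega> - Y n \<omega> \<in> UNIV}
      = (\<integral>\<^sup>+ \<omega>. indicator {True} (Z \<omega>) * ennreal (if J n \<omega> = \<infinity> then 0
            else exp (- rate (Y n \<omega>) * 0) * (rate (Y n \<omega>) / rate (Y n \<omega>))) \<partial>M)"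
    by (rule next_jump_rectangle[OF Z]) auto
  also have "\<dots> = (\<integral>\<^sup>+ \<omega>. indicator {\<omega> \<in> space M. Z \<omega>} \<omega> \<partial>M)"
    by (intro nn_integral_cong) (auto simp: Z_def split: split_indicator)
  also have "\<dots> = emeasure M {\<omega> \<in> space M. Z \<omega>}" by simp
  also have "{\<omega> \<in> space M. Z \<omega> \<in> {True} \<and> J n \<omega> + ereal 0 < J (Suc n) \<omega> \<and> J (Suc n) \<omega> < \<infinity> \<and>
           Y (Suc n) \<omega> - Y n \<omega> \<in> UNIV} = {\<omega> \<in> space M. Z \<omega> \<and> J (Suc n) \<omega> < \<infinity>}"
    using J_less_Suc[of _ n] by (auto simp: Z_def zero_ereal_def[symmetric])
  finally have eq: "emeasure M {\<omega> \<in> space M. Z \<omega> \<and> J (Suc n) \<omega> < \<infinity>} = emeasure M {\<omega> \<in> space M. Z \<omega>}" .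
  have "emeasure M ({\<omega> \<in> space M. Z \<omega>} - {\<omega> \<in> space M. Z \<omega> \<and> J (Suc n) \<omega> < \<infinity>}) = 0"
    by (subst emeasure_Diff) (simp_all only: eq, auto simp: emeasure_eq_measure)
  then show ?thesis
    by (intro AE_I'[of "{\<omega> \<in> space M. Z \<omega>} - {\<omega> \<in> space M. Z \<omega> \<and> J (Suc n) \<omega> < \<infinity>}"])
      (auto simp: null_sets_def Z_def)
qed

text \<open>The moment bounds are required only inside \<open>S\<close>, which is why everything below stops at the first state outside
  \<open>S\<close>.\<close>
locale saddle_jump_chain = jump_chain +
  fixes S :: "(real^2) set" and \<mu> l d c t\<^sub>0 \<delta> v :: real
  assumes S [measurable]: "S \<in> sets borel"
    and l: "l > 0" and \<mu>: "\<mu> > 0" and d: "d \<ge> 0" and c: "c > 0" and t\<^sub>0: "t\<^sub>0 \<ge> 0" and v: "v \<ge> 0"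
    and budget: "4 * \<delta>\<^sup>2 / l + 2 * v \<le> l * d"
    and integrable_jump: "\<And>y. y \<in> S \<Longrightarrow> y \<in> D \<Longrightarrow> integrable (K y) (\<lambda>\<xi>. \<xi>)"
    and integrable_jump_sq: "\<And>y. y \<in> S \<Longrightarrow> y \<in> D \<Longrightarrow> integrable (K y) (\<lambda>\<xi>. (norm \<xi>)\<^sup>2)"
    and mean_jump: "\<And>y. y \<in> S \<Longrightarrow> y \<in> D \<Longrightarrow> norm ((\<integral>\<xi>. \<xi> \<partial>K y) - saddle_matrix \<mu> l *v y) \<le> \<delta>"
    and second_moment_jump: "\<And>y. y \<in> S \<Longrightarrow> y \<in> D \<Longrightarrow> (\<integral>\<xi>. (norm \<xi>)\<^sup>2 \<partial>K y) \<le> v"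
begin

text \<open>The time \<open>0\<close> value of the reference trajectory. The state at \<open>t\<^sub>0\<close> is only known once \<open>t\<^sub>0\<close> lies in the past; until
  then the reference is the one belonging to the current state, so that it is determined by the first \<open>n\<close> jumps.\<close>
primrec reference :: "nat \<Rightarrow> 'a \<Rightarrow> real^2" where
  "reference 0 \<omega> = saddle_flow \<mu> l (- t\<^sub>0) (Y 0 \<omega>)"
| "reference (Suc n) \<omega> = (if J (Suc n) \<omega> \<le> ereal t\<^sub>0
     then saddle_flow \<mu> l (- t\<^sub>0) (Y (Suc n) \<omega>) else reference n \<omega>)"

lemma reference_early: "\<omega> \<in> space M \<Longrightarrow> J n \<omega> \<le> ereal t\<^sub>0 \<Longrightarrow> reference n \<omega> = saddle_flow \<mu> l (- t\<^sub>0) (Y n \<omega>)"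
  by (cases n) auto

text \<open>The chain is alive at step \<open>n\<close> if the \<open>n\<close>-th jump takes place and the path neither left \<open>S\<close> nor crossed the
  level \<open>c\<close> before it.\<close>
primrec alive :: "nat \<Rightarrow> 'a \<Rightarrow> bool" where
  "alive 0 \<omega> \<longleftrightarrow> True"
| "alive (Suc n) \<omega> \<longleftrightarrow> alive n \<omega> \<and> Y n \<omega> \<in> S \<and> J (Suc n) \<omega> < \<infinity> \<and>
     \<not> exceeds \<mu> l c (max (clock n \<omega>) t\<^sub>0) (J (Suc n) \<omega>) (Y n \<omega>) (reference n \<omega>)"

lemma alive_imp_finite: "\<omega> \<in> space M \<Longrightarrow> alive n \<omega> \<Longrightarrow> J n \<omega> < \<infinity>"
  by (cases n) (auto simp: J_0)

text \<open>The first crossing takes place in the \<open>n\<close>-th holding interval. In a state outside \<open>S\<close> the process has just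
  left \<open>S\<close>, and only the moment of exit itself counts.\<close>
definition crossing :: "nat \<Rightarrow> 'a set" where
  "crossing n = {\<omega> \<in> space M. alive n \<omega> \<and>
     (if Y n \<omega> \<in> S then exceeds \<mu> l c (max (clock n \<omega>) t\<^sub>0) (J (Suc n) \<omega>) (Y n \<omega>) (reference n \<omega>)
      else c < scaled_dev \<mu> l (max (clock n \<omega>) t\<^sub>0) (Y n \<omega>) (reference n \<omega>))}"

definition energy :: "nat \<Rightarrow> 'a \<Rightarrow> real" where
  "energy n \<omega> = lyapunov \<mu> l d (max (clock n \<omega>) t\<^sub>0) (Y n \<omega>) (reference n \<omega>)"

lemma clock_measurable_history:
  assumes "k \<le> n"
  shows "clock k \<in> borel_measurable (history n)"
proof -
  note [measurable] = J_Y_measurable_history(1)[OF assms]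
  show ?thesis unfolding clock_def[abs_def] by measurable
qed

lemma reference_measurable_history: "k \<le> n \<Longrightarrow> reference k \<in> borel_measurable (history n)"
proof (induction k)
  case 0
  note [measurable] = J_Y_measurable_history[OF 0]
  have "reference 0 = (\<lambda>\<omega>. saddle_flow \<mu> l (- t\<^sub>0) (Y 0 \<omega>))" by auto
  then show ?case by simp
next
  case (Suc k)
  note [measurable] = J_Y_measurable_history[OF Suc.prems] Suc.IH[OF Suc_leD[OF Suc.prems]]
  have "reference (Suc k) = (\<lambda>\<omega>. if J (Suc k) \<omega> \<le> ereal t\<^sub>0
     then saddle_flow \<mu> l (- t\<^sub>0) (Y (Suc k) \<omega>) else reference k \<omega>)" by auto
  then show ?case by simp
qed

lemma alive_measurable_history: "k \<le> n \<Longrightarrow> Measurable.pred (history n) (alive k)"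
proof (induction k)
  case 0
  have "alive 0 = (\<lambda>\<omega>. True)" by auto
  then show ?case by simp
next
  case (Suc k)
  note k = Suc_leD[OF Suc.prems]
  note [measurable] = J_Y_measurable_history[OF Suc.prems] J_Y_measurable_history[OF k]
    clock_measurable_history[OF k] reference_measurable_history[OF k] Suc.IH[OF k]
  have "alive (Suc k) = (\<lambda>\<omega>. alive k \<omega> \<and> Y k \<omega> \<in> S \<and> J (Suc k) \<omega> < \<infinity> \<and>
     \<not> exceeds \<mu> l c (max (clock k \<omega>) t\<^sub>0) (J (Suc k) \<omega>) (Y k \<omega>) (reference k \<omega>))" by auto
  then show ?case by simp
qed

lemmas [measurable] = reference_measurable_history[OF order_refl, THEN measurable_if_history]
  alive_measurable_history[OF order_refl, THEN measurable_if_history]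

lemma energy_measurable [measurable]: "energy n \<in> borel_measurable M"
  unfolding energy_def[abs_def] by measurable

lemma crossing_measurable [measurable]: "crossing n \<in> sets M"
  unfolding crossing_def if_bool_eq_disj by measurable

text \<open>The one-step inequality, integrated over the past with \<open>nn_integral_next_jump\<close>. The function \<open>f\<close> below pays
  \<open>c\<close> if the level is crossed before the next jump and the new Lyapunov value otherwise; \<open>h\<close> collects the crossings that
  are not followed by a jump and those at the moment of exit.\<close>
lemma energy_decrease:
  "(\<integral>\<^sup>+ \<omega>. indicator {\<omega>. alive (Suc n) \<omega>} \<omega> * ennreal (energy (Suc n) \<omega>) \<partial>M) + ennreal c * emeasure M (crossing n)
    \<le> (\<integral>\<^sup>+ \<omega>. indicator {\<omega>. alive n \<omega>} \<omega> * ennreal (energy n \<omega>) \<partial>M)"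
proof -
  let ?T = "(borel :: real measure) \<Otimes>\<^sub>M (borel :: (real^2) measure) \<Otimes>\<^sub>M (borel :: (real^2) measure)
    \<Otimes>\<^sub>M (count_space UNIV :: bool measure)"
  define Z where "Z \<omega> = (clock n \<omega>, Y n \<omega>, reference n \<omega>, alive n \<omega> \<and> Y n \<omega> \<in> S)" for \<omega>
  define f :: "(real \<times> (real^2) \<times> (real^2) \<times> bool) \<times> real \<times> (real^2) \<Rightarrow> ennreal" where
    "f = (\<lambda>((t, y, p, ok), r, \<xi>). if ok then
        (if exceeds \<mu> l c (max t t\<^sub>0) (ereal (t + r)) y p then ennreal c
         else ennreal (lyapunov \<mu> l d (max (t + r) t\<^sub>0) (y + \<xi>)
           (if t + r \<le> t\<^sub>0 then saddle_flow \<mu> l (- t\<^sub>0) (y + \<xi>) else p))) else 0)"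
  define h where "h \<omega> = (if alive n \<omega> \<and>
      (if Y n \<omega> \<in> S then rate (Y n \<omega>) = 0 \<and> exceeds \<mu> l c (max (clock n \<omega>) t\<^sub>0) \<infinity> (Y n \<omega>) (reference n \<omega>)
       else c < scaled_dev \<mu> l (max (clock n \<omega>) t\<^sub>0) (Y n \<omega>) (reference n \<omega>)) then ennreal c else 0)" for \<omega>
  have Z: "Z \<in> measurable (history n) ?T"
  proof -
    note [measurable] = J_Y_measurable_history[OF order_refl, of n] clock_measurable_history[OF order_refl, of n]
      reference_measurable_history[OF order_refl, of n] alive_measurable_history[OF order_refl, of n]
    show ?thesis unfolding Z_def[abs_def] by measurable
  qed
  have f: "f \<in> borel_measurable (?T \<Otimes>\<^sub>M borel \<Otimes>\<^sub>M borel)"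
    unfolding f_def case_prod_beta by measurable
  have [measurable]: "h \<in> borel_measurable M" unfolding h_def[abs_def] by measurable
  define F where "F \<omega> = indicator {\<omega>. J (Suc n) \<omega> < \<infinity>} \<omega> *
      f (Z \<omega>, clock (Suc n) \<omega> - clock n \<omega>, Y (Suc n) \<omega> - Y n \<omega>)" for \<omega>
  define G where "G \<omega> = indicator {\<omega>. J n \<omega> < \<infinity>} \<omega> *
      (\<integral>\<^sup>+ r. indicator {0<..} r * ennreal (exp (- rate (Y n \<omega>) * r)) *
         (\<integral>\<^sup>+ \<xi>. f (Z \<omega>, r, \<xi>) \<partial>K (Y n \<omega>)) \<partial>lborel)" for \<omega>
  have [measurable]: "F \<in> borel_measurable M"
  proof -
    note [measurable] = f measurable_if_history[OF Z]
    show ?thesis unfolding F_def[abs_def] by measurable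
  qed
  define W where "W \<omega> = indicator {\<omega>. alive n \<omega>} \<omega> * ennreal (energy n \<omega>)" for \<omega>
  have [measurable]: "W \<in> borel_measurable M" unfolding W_def[abs_def] by measurable
  have pointwise: "G \<omega> + h \<omega> \<le> W \<omega>" if \<omega>: "\<omega> \<in> space M" for \<omega>
  proof (cases "alive n \<omega> \<and> Y n \<omega> \<in> S")
    case True
    have fin: "J n \<omega> < \<infinity>" using alive_imp_finite[OF \<omega>] True by simp
    interpret kern: saddle_jump_kernel \<mu> l d c t\<^sub>0 \<delta> v "K (Y n \<omega>)" "Y n \<omega>" "reference n \<omega>"
      by (intro saddle_jump_kernel.intro l \<mu> d c t\<^sub>0 v budget kernel_sets kernel_finite integrable_jump
          integrable_jump_sq mean_jump second_moment_jump Y_in \<omega>) (use True in auto)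
    have "(\<integral>\<^sup>+ \<xi>. f (Z \<omega>, r, \<xi>) \<partial>K (Y n \<omega>)) =
        (if exceeds \<mu> l c (max (clock n \<omega>) t\<^sub>0) (ereal (clock n \<omega> + r)) (Y n \<omega>) (reference n \<omega>)
         then ennreal (c * rate (Y n \<omega>)) else kern.after_jump (clock n \<omega> + r))" for r
      using True c by (auto simp: f_def Z_def kern.after_jump_def kern.space_kappa emeasure_kernel Y_in \<omega> ennreal_mult)
    moreover have "clock n \<omega> \<le> t\<^sub>0 \<Longrightarrow> reference n \<omega> = saddle_flow \<mu> l (- t\<^sub>0) (Y n \<omega>)"
      using J_eq_clock[OF \<omega> fin] by (intro reference_early[OF \<omega>]) simp
    ultimately show ?thesis
      using True fin kern.holding_interval[of "clock n \<omega>"]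
      by (simp add: G_def h_def W_def energy_def mult.assoc)
  next
    case False
    have "f (Z \<omega>, r, \<xi>) = 0" for r \<xi> using False by (auto simp: f_def Z_def)
    then have "G \<omega> = 0" by (simp add: G_def)
    moreover have "ennreal c \<le> ennreal (energy n \<omega>)"
      if "c < scaled_dev \<mu> l (max (clock n \<omega>) t\<^sub>0) (Y n \<omega>) (reference n \<omega>)"
      using that scaled_dev_le_lyapunov[OF d, of \<mu> l "max (clock n \<omega>) t\<^sub>0" "Y n \<omega>" "reference n \<omega>"]
      unfolding energy_def by (intro ennreal_leI) linarith
    ultimately show ?thesis using False by (auto simp: h_def W_def)
  qed
  have "(\<integral>\<^sup>+ \<omega>. indicator {\<omega>. alive (Suc n) \<omega>} \<omega> * ennreal (energy (Suc n) \<omega>) \<partial>M) + ennreal c * emeasure M (crossing n)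
      = (\<integral>\<^sup>+ \<omega>. indicator {\<omega>. alive (Suc n) \<omega>} \<omega> * ennreal (energy (Suc n) \<omega>)
          + ennreal c * indicator (crossing n) \<omega> \<partial>M)"
    by (subst nn_integral_add) (auto simp: nn_integral_cmult_indicator)
  also have "\<dots> \<le> (\<integral>\<^sup>+ \<omega>. F \<omega> + h \<omega> \<partial>M)"
  proof (rule nn_integral_mono_AE)
    show "AE \<omega> in M. indicator {\<omega>. alive (Suc n) \<omega>} \<omega> * ennreal (energy (Suc n) \<omega>)
          + ennreal c * indicator (crossing n) \<omega> \<le> F \<omega> + h \<omega>"
      using jump_if_rate_pos[of n] AE_space
    proof eventually_elim
      case (elim \<omega>)
      note \<omega> = elim(2)
      have crossing_iff: "\<omega> \<in> crossing n \<longleftrightarrow> alive n \<omega> \<and>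
          (if Y n \<omega> \<in> S then exceeds \<mu> l c (max (clock n \<omega>) t\<^sub>0) (J (Suc n) \<omega>) (Y n \<omega>) (reference n \<omega>)
           else c < scaled_dev \<mu> l (max (clock n \<omega>) t\<^sub>0) (Y n \<omega>) (reference n \<omega>))"
        using \<omega> by (simp add: crossing_def)
      show ?case
      proof (cases "J (Suc n) \<omega> < \<infinity>")
        case True
        then have "ereal (clock n \<omega> + (clock (Suc n) \<omega> - clock n \<omega>)) = J (Suc n) \<omega>"
          using J_eq_clock[OF \<omega> True] by simp
        then show ?thesis
          using True J_eq_clock[OF \<omega> True]
          by (auto simp: F_def f_def Z_def h_def crossing_iff energy_def
              split: split_indicator intro: add_increasing2)
      next
        case False
        then have J_Suc: "J (Suc n) \<omega> = \<infinity>" by simp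
        have "rate (Y n \<omega>) = 0" if "alive n \<omega>"
          using elim(1) False alive_imp_finite[OF \<omega> that] measure_nonneg[of "K (Y n \<omega>)" UNIV]
          by (auto simp: less_le)
        then show ?thesis using J_Suc by (auto simp: crossing_iff h_def split: split_indicator)
      qed
    qed
  qed
  also have "\<dots> = (\<integral>\<^sup>+ \<omega>. F \<omega> \<partial>M) + (\<integral>\<^sup>+ \<omega>. h \<omega> \<partial>M)"
    by (intro nn_integral_add) auto
  also have "(\<integral>\<^sup>+ \<omega>. F \<omega> \<partial>M) = (\<integral>\<^sup>+ \<omega>. G \<omega> \<partial>M)"
    unfolding F_def G_def by (rule nn_integral_next_jump[OF Z f])
  also have "\<dots> + (\<integral>\<^sup>+ \<omega>. h \<omega> \<partial>M) \<le> (\<integral>\<^sup>+ \<omega>. W \<omega> - h \<omega> \<partial>M) + (\<integral>\<^sup>+ \<omega>. h \<omega> \<partial>M)"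
  proof (intro add_right_mono nn_integral_mono)
    fix \<omega> assume "\<omega> \<in> space M"
    then have "(G \<omega> + h \<omega>) - h \<omega> \<le> W \<omega> - h \<omega>"
      by (intro ennreal_minus_mono pointwise) auto
    moreover have "h \<omega> \<noteq> \<top>" by (simp add: h_def)
    ultimately show "G \<omega> \<le> W \<omega> - h \<omega>" by simp
  qed
  also have "\<dots> = (\<integral>\<^sup>+ \<omega>. (W \<omega> - h \<omega>) + h \<omega> \<partial>M)"
    by (intro nn_integral_add[symmetric]) auto
  also have "\<dots> = (\<integral>\<^sup>+ \<omega>. W \<omega> \<partial>M)"
  proof (intro nn_integral_cong diff_add_cancel_ennreal)
    fix \<omega> assume "\<omega> \<in> space M"
    from pointwise[OF this] show "h \<omega> \<le> W \<omega>"
      using order_trans[OF add_increasing[of "G \<omega>" "h \<omega>" "h \<omega>"]] by auto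
  qed
  finally show ?thesis by (simp only: W_def)
qed

text \<open>The sum of the one-step inequalities telescopes to the initial value of the Lyapunov function,
  which is deterministic since the reference starts on the process.\<close>
lemma prob_crossing_le: "prob (\<Union>n. crossing n) \<le> d * exp (- l * t\<^sub>0) / c"
proof -
  define W where "W n = (\<integral>\<^sup>+ \<omega>. indicator {\<omega>. alive n \<omega>} \<omega> * ennreal (energy n \<omega>) \<partial>M)" for n
  have total: "(\<Sum>k<n. ennreal c * emeasure M (crossing k)) + W n \<le> ennreal (d * exp (- l * t\<^sub>0))" for n
  proof (induction n)
    case 0
    have "W 0 = (\<integral>\<^sup>+ \<omega>. ennreal (d * exp (- l * t\<^sub>0)) \<partial>M)"
      unfolding W_def
    proof (intro nn_integral_cong)
      fix \<omega> assume "\<omega> \<in> space M"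
      then have "clock 0 \<omega> = 0" by (simp add: clock_def J_0)
      then show "indicator {\<omega>. alive 0 \<omega>} \<omega> * ennreal (energy 0 \<omega>) = ennreal (d * exp (- l * t\<^sub>0))"
        using t\<^sub>0 by (simp add: energy_def lyapunov_at_reference max_absorb2 del: minus_mult_left)
    qed
    then show ?case by (simp add: emeasure_space_1)
  next
    case (Suc n)
    have "(\<Sum>k<Suc n. ennreal c * emeasure M (crossing k)) + W (Suc n)
        = (\<Sum>k<n. ennreal c * emeasure M (crossing k)) + (W (Suc n) + ennreal c * emeasure M (crossing n))"
      by (simp add: ac_simps)
    also have "\<dots> \<le> (\<Sum>k<n. ennreal c * emeasure M (crossing k)) + W n"
      unfolding W_def by (intro add_left_mono energy_decrease)
    finally show ?case using Suc.IH by (rule order_trans)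
  qed
  have partial: "(\<Sum>k<n. ennreal c * emeasure M (crossing k)) \<le> ennreal (d * exp (- l * t\<^sub>0))" for n
    by (rule order_trans[OF _ total[of n]]) simp
  have "ennreal c * emeasure M (\<Union>n. crossing n) \<le> ennreal c * (\<Sum>k. emeasure M (crossing k))"
    by (intro mult_left_mono emeasure_subadditive_countably) auto
  also have "\<dots> = (\<Sum>k. ennreal c * emeasure M (crossing k))" by simp
  also have "\<dots> \<le> ennreal (d * exp (- l * t\<^sub>0))"
    unfolding suminf_eq_SUP by (intro SUP_least partial)
  finally have "c * prob (\<Union>n. crossing n) \<le> d * exp (- l * t\<^sub>0)"
    using c d by (simp add: emeasure_eq_measure flip: ennreal_mult)
  then show ?thesis using c by (simp add: pos_le_divide_eq mult.commute)
qed

end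

section \<open>From the jump chain to the path\<close>

lemma exit_time_le: "0 \<le> s \<Longrightarrow> X s \<omega> \<notin> S \<Longrightarrow> exit_time S X \<omega> \<le> ereal s"
  unfolding exit_time_def by (rule INF_lower) simp

context saddle_jump_chain begin

text \<open>Up to the exit time every state before the current one lies in \<open>S\<close>, so the chain can only stop being alive by crossing the
  level. Time \<open>t\<close> belongs to a holding interval in \<open>S\<close>, or is itself the exit time.\<close>
lemma deviation_imp_crossing:
  assumes \<omega>: "\<omega> \<in> space M"
    and nonexplosive: "\<And>t :: real. \<exists>n. ereal t < J n \<omega>"
    and X: "\<And>n t. J n \<omega> \<le> ereal t \<Longrightarrow> ereal t < J (Suc n) \<omega> \<Longrightarrow> X t \<omega> = Y n \<omega>"
    and t: "t\<^sub>0 \<le> t" "ereal t \<le> exit_time S X \<omega>"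
    and dev: "c < exp (- 2 * l * t) * (norm (X t \<omega> - saddle_flow \<mu> l (t - t\<^sub>0) (X t\<^sub>0 \<omega>)))\<^sup>2"
  shows "\<exists>n. \<omega> \<in> crossing n"
proof -
  have index: "\<exists>n. J n \<omega> \<le> ereal s \<and> ereal s < J (Suc n) \<omega>" if s: "0 \<le> s" for s
  proof -
    define m where "m = (LEAST n. ereal s < J n \<omega>)"
    have m: "ereal s < J m \<omega>" unfolding m_def using nonexplosive by (rule LeastI_ex)
    then obtain n where n: "m = Suc n" using m s J_0[OF \<omega>] by (cases m) auto
    then have "\<not> ereal s < J n \<omega>" unfolding m_def using not_less_Least by (metis lessI)
    then show ?thesis using m n by (auto simp: not_less)
  qed
  obtain m where m: "J m \<omega> \<le> ereal t\<^sub>0" "ereal t\<^sub>0 < J (Suc m) \<omega>" using index[OF t\<^sub>0] by blast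
  obtain n where n: "J n \<omega> \<le> ereal t" "ereal t < J (Suc n) \<omega>" using index[of t] t t\<^sub>0 by auto
  have "m \<le> n"
  proof (rule ccontr)
    assume "\<not> m \<le> n"
    then have "J (Suc n) \<omega> \<le> J m \<omega>" by (intro J_mono[OF \<omega>]) simp
    then have "ereal t < ereal t\<^sub>0" using n(2) m(1) by (meson less_le_trans)
    then show False using t by simp
  qed
  have "reference k \<omega> = saddle_flow \<mu> l (- t\<^sub>0) (Y m \<omega>)" if "m \<le> k" for k
    using that
  proof (induction k rule: dec_induct)
    case base
    show ?case by (rule reference_early[OF \<omega> m(1)])
  next
    case (step k)
    have "ereal t\<^sub>0 < J (Suc k) \<omega>"
      using m(2) J_mono[OF \<omega>, of "Suc m" "Suc k"] step by (simp add: less_le_trans)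
    then show ?case using step by (simp add: less_le_not_le)
  qed
  then have ref: "reference n \<omega> = saddle_flow \<mu> l (- t\<^sub>0) (Y m \<omega>)" using \<open>m \<le> n\<close> .
  have dev_n: "c < scaled_dev \<mu> l t (Y n \<omega>) (reference n \<omega>)"
    using dev X[OF n] X[OF m] by (simp add: scaled_dev_def ref saddle_flow_compose)
  have J_fin: "J k \<omega> = ereal (clock k \<omega>)" if "k \<le> n" for k
    using J_mono[OF \<omega> that] n(1) by (intro J_eq_clock[OF \<omega>]) (auto intro: order.strict_trans1)
  have exit: "exit_time S X \<omega> \<le> J k \<omega>" if "k \<le> n" "Y k \<omega> \<notin> S" for k
  proof -
    have "X (clock k \<omega>) \<omega> = Y k \<omega>"
      using J_less_Suc[OF \<omega>, of k] J_fin[OF that(1)] by (intro X) auto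
    then show ?thesis
      using exit_time_le[of "clock k \<omega>" X \<omega> S] clock_nonneg[OF \<omega>, of k] that J_fin by simp
  qed
  have before: "Y k \<omega> \<in> S" if "k < n" for k
  proof (rule ccontr)
    assume "Y k \<omega> \<notin> S"
    then have "ereal t \<le> J k \<omega>" using exit[of k] that t(2) by (meson less_imp_le order_trans)
    also have "J k \<omega> < J (Suc k) \<omega>" using J_fin[of k] that by (intro J_less_Suc[OF \<omega>]) simp
    also have "\<dots> \<le> J n \<omega>" using that by (intro J_mono[OF \<omega>]) simp
    finally show False using n(1) by simp
  qed
  show ?thesis
  proof (rule ccontr)
    assume no: "\<nexists>n. \<omega> \<in> crossing n"
    have "alive k \<omega>" if "k \<le> n" for k
      using that
    proof (induction k)
      case (Suc k)
      then have "alive k \<omega>" "Y k \<omega> \<in> S" using before[of k] by auto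
      then show ?case using no \<omega> J_fin[OF Suc.prems] by (auto simp: crossing_def)
    qed simp
    then have alive: "alive n \<omega>" by simp
    have clock_le: "max (clock n \<omega>) t\<^sub>0 \<le> t" using n(1) t J_fin[of n] by simp
    have "\<omega> \<in> crossing n"
    proof (cases "Y n \<omega> \<in> S")
      case True
      then show ?thesis
        using exceedsI[OF clock_le n(2) dev_n] alive \<omega> by (simp add: crossing_def)
    next
      case False
      have "ereal t \<le> J n \<omega>" using exit[of n] False t(2) by (simp add: order_trans)
      then have "max (clock n \<omega>) t\<^sub>0 = t" using n(1) J_fin[of n] t by simp
      then show ?thesis using False alive \<omega> dev_n by (simp add: crossing_def)
    qed
    then show False using no by blast
  qed
qed

text \<open>The event on the left is contained in a measurable one. If it is not measurable itself, \<open>prob\<close> assigns it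
  the value \<open>0\<close>.\<close>
lemma prob_deviation_le:
  assumes nonexplosive: "\<And>\<omega> t :: real. \<omega> \<in> space M \<Longrightarrow> \<exists>n. ereal t < J n \<omega>"
    and X: "\<And>\<omega> n t. \<omega> \<in> space M \<Longrightarrow> J n \<omega> \<le> ereal t \<Longrightarrow> ereal t < J (Suc n) \<omega> \<Longrightarrow> X t \<omega> = Y n \<omega>"
    and \<rho>: "\<rho> \<ge> 0" "c = \<rho>\<^sup>2"
  shows "prob {\<omega> \<in> space M.
      (SUP t\<in>{t. t\<^sub>0 \<le> t \<and> ereal t \<le> exit_time S X \<omega>}.
         ereal (exp (- l * t) * norm (X t \<omega> - saddle_flow \<mu> l (t - t\<^sub>0) (X t\<^sub>0 \<omega>)))) > ereal \<rho>}
    \<le> d * exp (- l * t\<^sub>0) / c" (is "prob ?E \<le> _")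
proof -
  have "?E \<subseteq> (\<Union>n. crossing n)"
  proof
    fix \<omega> assume "\<omega> \<in> ?E"
    then obtain t where \<omega>: "\<omega> \<in> space M" and t: "t\<^sub>0 \<le> t" "ereal t \<le> exit_time S X \<omega>"
      and dev: "\<rho> < exp (- l * t) * norm (X t \<omega> - saddle_flow \<mu> l (t - t\<^sub>0) (X t\<^sub>0 \<omega>))"
      by (auto simp: less_SUP_iff)
    have "\<rho>\<^sup>2 < (exp (- l * t) * norm (X t \<omega> - saddle_flow \<mu> l (t - t\<^sub>0) (X t\<^sub>0 \<omega>)))\<^sup>2"
      using dev \<rho>(1) by (rule power_strict_mono) simp
    then have "c < exp (- 2 * l * t) * (norm (X t \<omega> - saddle_flow \<mu> l (t - t\<^sub>0) (X t\<^sub>0 \<omega>)))\<^sup>2"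
      by (simp add: \<rho>(2) power_mult_distrib mult.assoc flip: exp_double)
    then show "\<omega> \<in> (\<Union>n. crossing n)"
      using deviation_imp_crossing[OF \<omega> nonexplosive[OF \<omega>] X[OF \<omega>] t] by blast
  qed
  then have "prob ?E \<le> prob (\<Union>n. crossing n)"
    by (cases "?E \<in> sets M") (auto intro!: finite_measure_mono simp: measure_notin_sets)
  also have "\<dots> \<le> d * exp (- l * t\<^sub>0) / c" by (rule prob_crossing_le)
  finally show ?thesis .
qed

end

section \<open>The scaling limit\<close>

lemma laplace_rescaled_le:
  fixes a b :: ennreal
  assumes N: "N > 0" and close: "\<bar>enn2ereal a / ereal (real N) - enn2ereal b\<bar> < 1" and b: "b \<le> ennreal C" and C: "C \<ge> 0"
  shows "a \<le> ennreal (real N * (C + 1))"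
proof -
  have "b < \<top>" using b by (rule order.strict_trans1) simp
  then obtain b' where b': "b = ennreal b'" "b' \<ge> 0" by (cases b) auto
  then have bC: "b' \<le> C" using b C by simp
  show ?thesis
  proof (cases a)
    case (real a')
    then have "\<bar>a' / real N - b'\<bar> < 1" using close b' N by (simp add: enn2ereal_ennreal)
    then have "a' / real N < C + 1" using bC by linarith
    then have "a' \<le> real N * (C + 1)" using N by (simp add: pos_divide_less_eq mult.commute)
    then show ?thesis using real by (simp add: ennreal_leI)
  next
    case top
    then show ?thesis using close b' N by (simp add: enn2ereal_ennreal)
  qed
qed

lemma pure_jump_markov_imp_chain:
  assumes "pure_jump_markov M D K x\<^sub>0 X"
  shows "\<exists>J Y. jump_chain M D K J Y \<and> (\<forall>\<omega>\<in>space M. \<forall>t::real. \<exists>n. ereal t < J n \<omega>) \<and>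
    (\<forall>\<omega>\<in>space M. \<forall>n t. J n \<omega> \<le> ereal t \<longrightarrow> ereal t < J (Suc n) \<omega> \<longrightarrow> X t \<omega> = Y n \<omega>)"
  using assms unfolding pure_jump_markov_def jump_chain_def jump_chain_axioms_def
  apply (elim conjE exE)
  subgoal for J Y by (rule exI[of _ J], rule exI[of _ Y]) simp
  done

text \<open>All powers of \<open>N\<close> cancel: the square of the drift error, the second moment of the jumps and the square of the level
  are all of order \<open>1 / N\<close>.\<close>
lemma prob_late_deviation_le:
  fixes M :: "'w measure" and \<kappa> :: "real^2 \<Rightarrow> (real^2) measure" and S :: "(real^2) set"
  assumes markov: "pure_jump_markov M D \<kappa> x\<^sub>0 X"
    and S: "S \<in> sets borel" and pos: "r > 0" "C \<ge> 0" "l > 0" "\<mu> > 0" "\<epsilon> > 0" "t\<^sub>0 \<ge> 0" "N > 0"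
    and bound: "\<And>x \<theta>. x \<in> D \<Longrightarrow> x \<in> S \<Longrightarrow> norm \<theta> \<le> real N * r \<Longrightarrow>
        laplace (\<kappa> x) \<theta> \<le> ennreal (real N * C)"
    and drift: "\<And>x. x \<in> D \<Longrightarrow> x \<in> S \<Longrightarrow>
        norm (drift (\<kappa> x) - saddle_matrix \<mu> l *v x) \<le> real N powr (- 1/2)"
  shows "measure M {\<omega> \<in> space M.
      (SUP t\<in>{t. t\<^sub>0 \<le> t \<and> ereal t \<le> exit_time S X \<omega>}.
         ereal (exp (- l * t) * norm (X t \<omega> - saddle_flow \<mu> l (t - t\<^sub>0) (X t\<^sub>0 \<omega>))))
      > ereal (real N powr (- 1/2) * \<epsilon>)}
    \<le> (4 / l + 64 * C / r\<^sup>2) / l * exp (- l * t\<^sub>0) / \<epsilon>\<^sup>2"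
proof -
  obtain J Y where chain: "jump_chain M D \<kappa> J Y"
    and nonexplosive: "\<And>\<omega> t :: real. \<omega> \<in> space M \<Longrightarrow> \<exists>n. ereal t < J n \<omega>"
    and X: "\<And>\<omega> n t. \<omega> \<in> space M \<Longrightarrow> J n \<omega> \<le> ereal t \<Longrightarrow> ereal t < J (Suc n) \<omega> \<Longrightarrow> X t \<omega> = Y n \<omega>"
    using pure_jump_markov_imp_chain[OF markov] by blast
  define \<delta> where "\<delta> = real N powr (- 1/2)"
  define v where "v = 32 * C / r\<^sup>2 / real N"
  define d where "d = (4 / l + 64 * C / r\<^sup>2) / l / real N"
  have \<delta>2: "\<delta>\<^sup>2 = 1 / real N"
    using pos by (simp add: \<delta>_def powr_minus_divide power2_eq_square flip: powr_add)
  have vpos: "v \<ge> 0" "d \<ge> 0" using pos by (auto simp: v_def d_def)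
  have sets: "sets (\<kappa> x) = sets borel" and fin: "finite_measure (\<kappa> x)" if "x \<in> D" for x
    using jump_chain.kernel_sets[OF chain that] jump_chain.kernel_finite[OF chain that] .
  have rN: "real N * r > 0" and CN: "real N * C \<ge> 0" using pos by auto
  have second: "32 * (real N * C) / (real N * r)\<^sup>2 = v"
    using pos by (simp add: v_def power2_eq_square field_simps)
  interpret jump_chain M D \<kappa> J Y by (rule chain)
  interpret saddle_jump_chain M D \<kappa> J Y S \<mu> l d "(\<delta> * \<epsilon>)\<^sup>2" t\<^sub>0 \<delta> v
  proof unfold_locales
    show "S \<in> sets borel" by (rule S)
    show "4 * \<delta>\<^sup>2 / l + 2 * v \<le> l * d"
    proof -
      have "l * d = (4 / l + 64 * C / r\<^sup>2) / real N" using pos by (simp add: d_def)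
      then show ?thesis by (simp add: \<delta>2 v_def add_divide_distrib mult.commute)
    qed
    fix y assume y: "y \<in> S" "y \<in> D"
    note moments = sets[OF y(2)] fin[OF y(2)] rN CN bound[OF y(2,1)]
    show "integrable (\<kappa> y) (\<lambda>\<xi>. \<xi>)" by (rule laplace_bound_integrable_id[OF moments])
    show "integrable (\<kappa> y) (\<lambda>\<xi>. (norm \<xi>)\<^sup>2)" by (rule laplace_bound_integrable_square[OF moments])
    show "norm ((\<integral>\<xi>. \<xi> \<partial>\<kappa> y) - saddle_matrix \<mu> l *v y) \<le> \<delta>"
    proof -
      have "drift (\<kappa> y) = (\<integral>\<xi>. \<xi> \<partial>\<kappa> y)" by (rule laplace_bound_drift[OF moments])
      then show ?thesis using drift[OF y(2,1)] by (simp add: \<delta>_def)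
    qed
    show "(\<integral>\<xi>. (norm \<xi>)\<^sup>2 \<partial>\<kappa> y) \<le> v"
      unfolding second[symmetric] by (rule laplace_bound_second_moment[OF moments])
  qed (use pos vpos in \<open>auto simp: \<delta>_def\<close>)
  have "prob {\<omega> \<in> space M.
      (SUP t\<in>{t. t\<^sub>0 \<le> t \<and> ereal t \<le> exit_time S X \<omega>}.
         ereal (exp (- l * t) * norm (X t \<omega> - saddle_flow \<mu> l (t - t\<^sub>0) (X t\<^sub>0 \<omega>)))) > ereal (\<delta> * \<epsilon>)}
    \<le> d * exp (- l * t\<^sub>0) / (\<delta> * \<epsilon>)\<^sup>2"
    using nonexplosive X pos by (intro prob_deviation_le) (auto simp: \<delta>_def)
  also have "\<dots> = (4 / l + 64 * C / r\<^sup>2) / l * exp (- l * t\<^sub>0) / \<epsilon>\<^sup>2"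
    using pos by (simp add: power_mult_distrib \<delta>2 d_def)
  finally show ?thesis by (simp add: \<delta>_def)
qed

theorem theorem2p2:
  fixes M :: "nat \<Rightarrow> 'w measure"
    and X :: "nat \<Rightarrow> real \<Rightarrow> 'w \<Rightarrow> real^2"
    and I :: "nat \<Rightarrow> (real^2) set"
    and KN :: "nat \<Rightarrow> real^2 \<Rightarrow> (real^2) measure"
    and K :: "real^2 \<Rightarrow> (real^2) measure"
    and S :: "(real^2) set"
    and x\<^sub>0 :: "real^2"
    and \<eta>\<^sub>0 \<mu> l \<epsilon> :: real
  assumes markov: "\<And>N. pure_jump_markov (M N) (I N) (KN N) x\<^sub>0 (X N)"
    and S: "open S" "x\<^sub>0 \<in> S"
    and K: "finite_kernel_on S K"
    and \<eta>\<^sub>0: "\<eta>\<^sub>0 > 0"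
    and bounded: "\<exists>C<\<infinity>. \<forall>x\<in>S. \<forall>\<theta>\<in>cball 0 \<eta>\<^sub>0. laplace (K x) \<theta> \<le> C"
    and laplace_conv:
      "(\<lambda>N. SUP x\<in>I N \<inter> S. SUP \<theta>\<in>cball 0 \<eta>\<^sub>0.
           \<bar>enn2ereal (laplace (KN N x) (real N *\<^sub>R \<theta>)) / ereal (real N) - enn2ereal (laplace (K x) \<theta>)\<bar>)
         \<longlonglongrightarrow> 0"
    and drift_conv:
      "(\<lambda>N. SUP x\<in>I N \<inter> S. ereal (real N powr (1/2) * norm (drift (KN N x) - drift (K x))))
         \<longlonglongrightarrow> 0"
    and diffusivity_lipschitz: "\<exists>L. L-lipschitz_on S (\<lambda>x. diffusivity (K x))"
    and rates: "l > 0" "\<mu> > 0"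
    and linear: "\<forall>x\<in>S. drift (K x) = saddle_matrix \<mu> l *v x"
    and start: "x\<^sub>0 $ 1 \<noteq> 0" "x\<^sub>0 $ 2 = 0"
    and path: "\<exists>U. open U \<and> (\<forall>t\<ge>0. saddle_flow \<mu> l t x\<^sub>0 \<in> U) \<and> U \<subseteq> S"
    and stopped_in_closure:
      "\<And>N. AE \<omega> in M N. \<forall>t\<ge>0. ereal t \<le> exit_time S (X N) \<omega> \<longrightarrow> X N t \<omega> \<in> closure S"
    and \<epsilon>: "\<epsilon> > 0"
  shows "((\<lambda>t\<^sub>0. limsup (\<lambda>N. ereal (measure (M N)
            {\<omega> \<in> space (M N).
               (SUP t\<in>{t. t\<^sub>0 \<le> t \<and> ereal t \<le> exit_time S (X N) \<omega>}.
                  ereal (exp (- l * t) *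
                         norm (X N t \<omega> - saddle_flow \<mu> l (t - t\<^sub>0) (X N t\<^sub>0 \<omega>))))
               > ereal (real N powr (- 1/2) * \<epsilon>)})))
          \<longlongrightarrow> 0) at_top"
proof -
  obtain C where C: "C \<ge> 0" and K_bound: "\<And>x \<theta>. x \<in> S \<Longrightarrow> norm \<theta> \<le> \<eta>\<^sub>0 \<Longrightarrow> laplace (K x) \<theta> \<le> ennreal C"
  proof -
    obtain C' where C': "C' < \<infinity>" "\<forall>x\<in>S. \<forall>\<theta>\<in>cball 0 \<eta>\<^sub>0. laplace (K x) \<theta> \<le> C'"
      using bounded by blast
    then show ?thesis using that by (cases C') auto
  qed
  define Q where "Q = (4 / l + 64 * (C + 1) / \<eta>\<^sub>0\<^sup>2) / l"
  define P where "P t\<^sub>0 N = measure (M N)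
            {\<omega> \<in> space (M N).
               (SUP t\<in>{t. t\<^sub>0 \<le> t \<and> ereal t \<le> exit_time S (X N) \<omega>}.
                  ereal (exp (- l * t) *
                         norm (X N t \<omega> - saddle_flow \<mu> l (t - t\<^sub>0) (X N t\<^sub>0 \<omega>))))
               > ereal (real N powr (- 1/2) * \<epsilon>)}" for t\<^sub>0 N
  have P_le: "\<forall>\<^sub>F N in sequentially. \<forall>t\<^sub>0\<ge>0. P t\<^sub>0 N \<le> Q * exp (- l * t\<^sub>0) / \<epsilon>\<^sup>2"
    using order_tendstoD(2)[OF laplace_conv, of 1, simplified] order_tendstoD(2)[OF drift_conv, of 1, simplified]
      eventually_gt_at_top[of 0]
  proof eventually_elim
    case (elim N)
    note N = elim(3)
    have close: "\<bar>enn2ereal (laplace (KN N x) (real N *\<^sub>R \<theta>)) / ereal (real N) - enn2ereal (laplace (K x) \<theta>)\<bar> < 1"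
      if "x \<in> I N" "x \<in> S" "norm \<theta> \<le> \<eta>\<^sub>0" for x \<theta>
      by (rule le_less_trans[OF _ elim(1)]) (rule SUP_upper2[of x], use that in \<open>auto intro!: SUP_upper2[of \<theta>]\<close>)
    have drift: "ereal (real N powr (1/2) * norm (drift (KN N x) - drift (K x))) < 1"
      if "x \<in> I N" "x \<in> S" for x
      by (rule le_less_trans[OF _ elim(2)]) (rule SUP_upper2[of x], use that in auto)
    show ?case
    proof (intro allI impI)
      fix t\<^sub>0 :: real assume "0 \<le> t\<^sub>0"
      then show "P t\<^sub>0 N \<le> Q * exp (- l * t\<^sub>0) / \<epsilon>\<^sup>2"
        unfolding P_def Q_def
      proof (intro prob_late_deviation_le[OF markov borel_open[OF S(1)]])
        fix x :: "real^2" and \<theta> :: "real^2"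
        assume x: "x \<in> I N" "x \<in> S" and \<theta>: "norm \<theta> \<le> real N * \<eta>\<^sub>0"
        define \<theta>' where "\<theta>' = (1 / real N) *\<^sub>R \<theta>"
        have \<theta>': "norm \<theta>' \<le> \<eta>\<^sub>0" "real N *\<^sub>R \<theta>' = \<theta>"
          using \<theta> N by (auto simp: \<theta>'_def field_simps)
        show "laplace (KN N x) \<theta> \<le> ennreal (real N * (C + 1))"
          using laplace_rescaled_le[OF N close[OF x \<theta>'(1)] K_bound[OF x(2) \<theta>'(1)] C] by (simp add: \<theta>'(2))
      next
        fix x :: "real^2" assume x: "x \<in> I N" "x \<in> S"
        have "real N powr (1/2) * norm (drift (KN N x) - drift (K x)) < 1"
          using drift[OF x] by simp
        then show "norm (drift (KN N x) - saddle_matrix \<mu> l *v x) \<le> real N powr (- 1/2)"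
          using linear x(2) N by (simp add: powr_minus_divide pos_le_divide_eq mult.commute)
      qed (use \<eta>\<^sub>0 C rates \<epsilon> N in auto)
    qed
  qed
  have upper: "\<forall>\<^sub>F t\<^sub>0 in at_top. limsup (\<lambda>N. ereal (P t\<^sub>0 N)) \<le> ereal (Q * exp (- l * t\<^sub>0) / \<epsilon>\<^sup>2)"
    using eventually_ge_at_top[of 0]
  proof eventually_elim
    case (elim t\<^sub>0)
    show ?case
      by (rule Limsup_bounded) (use P_le elim in \<open>auto elim!: eventually_mono\<close>)
  qed
  have lower: "0 \<le> limsup (\<lambda>N. ereal (P t\<^sub>0 N))" for t\<^sub>0
    by (intro le_Limsup) (auto simp: P_def)
  have "((\<lambda>t\<^sub>0. Q * exp (- l * t\<^sub>0) / \<epsilon>\<^sup>2) \<longlongrightarrow> 0) at_top"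
    using rates(1) \<epsilon> by real_asymp
  then have "((\<lambda>t\<^sub>0. ereal (Q * exp (- l * t\<^sub>0) / \<epsilon>\<^sup>2)) \<longlongrightarrow> 0) at_top"
    by (simp add: zero_ereal_def)
  from tendsto_sandwich[OF _ upper tendsto_const this]
  have "((\<lambda>t\<^sub>0. limsup (\<lambda>N. ereal (P t\<^sub>0 N))) \<longlongrightarrow> 0) at_top"
    using lower by simp
  then show ?thesis unfolding P_def .
qed

end
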